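(* Suppose that the suprema of the sets (i) $\{ \mathrm{Re}(z) : z \in \Lambda_\epsilon(T) \}$ and (ii) $\{ \mathcal{R}(\epsilon;\mu_0) : \mu_0 \in \Lambda(T) \}$ are attained, that every $\mu_0 \in \Lambda(T)$ is simple and isolated, and that $\epsilon > 0$ is sufficiently small so that $[0,\epsilon] \subset U_{\mu_0}$ for every $\mu_0 \in \Lambda(T)$. Then $$\alpha_\epsilon(T) = \max\{ \mathcal{R}(\epsilon;\mu_0) : \mu_0 \in \Lambda(T) \} = \max_{\mu_0 \in \Lambda(T)} \left\{ \mathrm{Re}(\mu_0) + \epsilon \left\{ \frac{\sqrt{w_1^2 |t_1(\mu_0)|^2 + \dots + w_\kappa^2 |t_\kappa(\mu_0)|^2}}{|y_{\mu_0}^\ast T'(\mu_0) x_{\mu_0}|} \right\} \right\} + \mathcal{O}(\epsilon^2),$$ where $x_{\mu_0}$ and $y_{\mu_0}$ denote a unit right eigenvector and a unit left eigenvector, respectively, corresponding to the eigenvalue $\mu_0$ of $T$ (that is, $\|x_{\mu_0}\|_2=\|y_{\mu_0}\|_2=1$, $T(\mu_0)x_{\mu_0}=0$, $y_{\mu_0}^\ast T(\mu_0)=0$).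
   Context: Let $\mathcal{D} \subseteq \mathbb{C}$ be open, let $t_1, \dots, t_\kappa : \mathcal{D} \to \mathbb{C}$ be holomorphic, let $T_1, \dots, T_\kappa \in \mathbb{C}^{n\times n}$, and let $T(\lambda) = \sum_{j=1}^\kappa t_j(\lambda) T_j$ on $\mathcal{D}$. $T$ is assumed regular, i.e., $\det T(\lambda)$ is not identically zero. The weights $w_1, \dots, w_\kappa$ are nonnegative reals with $\sum_{j=1}^\kappa w_j |t_j(\lambda)| \neq 0$ for all $\lambda \in \mathcal{D}$. An eigenvalue of a matrix-valued function $F$ on $\mathcal{D}$ is a point $\lambda\in\mathcal{D}$ with $\det F(\lambda) = 0$; $\Lambda(F)$ is the set of these (finite) eigenvalues. An eigenvalue is simple if it is a root of $\det F$ of multiplicity one, and isolated if it is the only eigenvalue in some neighborhood of it. For $\Delta = (\Delta T_1, \dots, \Delta T_\kappa)$, $\Delta T_j \in \mathbb{C}^{n \times n}$, put $\Delta T(\lambda) = \sum_{j=1}^\kappa t_j(\lambda) w_j \Delta T_j$. For $\epsilon>0$ let $\mathcal{S}_\epsilon = \{ (\Delta T_1, \dots, \Delta T_\kappa) : \| [\,\Delta T_1 \; \cdots \; \Delta T_\kappa\,] \|_2 \leq \epsilon \}$, with $\|\cdot\|_2$ the spectral norm of the $n\times \kappa n$ block row matrix, and $\mathcal{S} = \mathcal{S}_1$. The $\epsilon$-pseudospectrum is $\Lambda_\epsilon(T) = \bigcup \{ \Lambda(T + \Delta T) : \Delta T(\lambda)=\sum_j t_j(\lambda) w_j \Delta T_j,\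 (\Delta T_1,\dots,\Delta T_\kappa) \in \mathcal{S}_\epsilon \}$, and the $\epsilon$-pseudospectral abscissa is $\alpha_\epsilon(T) = \max\{\mathrm{Re}(z) : z \in \Lambda_\epsilon(T)\}$. For each simple isolated eigenvalue $\mu_0$ of $T$ there are an open interval $U_{\mu_0} \ni 0$ and $r > 0$ with $B_r(\mu_0) = \{z : |z-\mu_0| < r\} \subset \mathcal{D}$ such that for every $\Delta \in \mathcal{S}$ and $\eta \in U_{\mu_0}$ the function $T + \eta \Delta T$ has exactly one eigenvalue in $B_r(\mu_0)$, and it is simple; fix such $U_{\mu_0}$ and $r$. Denote this eigenvalue by $\mu(\eta; \Delta, \mu_0)$; $\eta \mapsto \mu(\eta;\Delta,\mu_0)$ is real-analytic on $U_{\mu_0}$ with value $\mu_0$ at $\eta=0$. For $[0,\epsilon]\subset U_{\mu_0}$ define $\mathcal{R}(\epsilon;\mu_0) = \max_{\Delta \in \mathcal{S}} \mathrm{Re}\{\mu(\epsilon;\Delta,\mu_0)\}$. The $\mathcal{O}(\epsilon^2)$ term is understood as $\epsilon \to 0^+$ with $T$ and the weights fixed.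
   Formalization: For the claims on α_ε(T) it is also assumed that some rightmost point of Λ_ε(T) ends a continuous curve of eigenvalues of T+ηΔT, 0≤η≤ε, in D, for some Δ in S (false otherwise); the last max over Λ(T) is a supremum, as the max need not exist. *)

theory Defs
  imports "HOL-Complex_Analysis.Complex_Analysis"
begin

text \<open>
  The dimension \<open>n\<close> and the number \<open>\<kappa>\<close> of coefficients are the cardinalities of the arbitrary
  finite types \<open>'n\<close> and \<open>'k\<close>.
\<close>

definition matfun ::
    "('k::finite \<Rightarrow> complex \<Rightarrow> complex) \<Rightarrow> ('k \<Rightarrow> complex^'n^'n) \<Rightarrow> complex \<Rightarrow> complex^'n^'n" where
  "matfun t M z = (\<Sum>j\<in>UNIV. map_matrix ((*) (t j z)) (M j))"

definition pert ::
    "('k::finite \<Rightarrow> complex \<Rightarrow> complex) \<Rightarrow> ('k \<Rightarrow> real) \<Rightarrow> ('k \<Rightarrow> complex^'n^'n) \<Rightarrow> complex \<Rightarrow> complex^'n^'n" where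
  "pert t w \<Delta> = matfun (\<lambda>j z. t j z * of_real (w j)) \<Delta>"

definition eigvals :: "complex set \<Rightarrow> (complex \<Rightarrow> complex^'n^'n) \<Rightarrow> complex set" where
  "eigvals D F = {z \<in> D. det (F z) = 0}"

definition simple_eigval :: "complex set \<Rightarrow> (complex \<Rightarrow> complex^'n^'n) \<Rightarrow> complex \<Rightarrow> bool" where
  "simple_eigval D F \<mu> \<longleftrightarrow> \<mu> \<in> eigvals D F \<and> zorder (\<lambda>z. det (F z)) \<mu> = 1"

definition block_row :: "('k::finite \<Rightarrow> complex^'n^'n) \<Rightarrow> complex^('k \<times> 'n)^'n" where
  "block_row \<Delta> = (\<chi> p q. \<Delta> (fst q) $ p $ snd q)"

text \<open>The norm on \<open>complex^'m\<close> is the Euclidean one, so the operator norm is the spectral norm.\<close>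

definition spectral_norm :: "complex^'m^'n \<Rightarrow> real" where
  "spectral_norm A = onorm ((*v) A)"

definition pert_set :: "real \<Rightarrow> ('k::finite \<Rightarrow> complex^'n^'n) set" where
  "pert_set \<epsilon> = {\<Delta>. spectral_norm (block_row \<Delta>) \<le> \<epsilon>}"

definition pseudospectrum ::
    "complex set \<Rightarrow> ('k::finite \<Rightarrow> complex \<Rightarrow> complex) \<Rightarrow> ('k \<Rightarrow> complex^'n^'n) \<Rightarrow> ('k \<Rightarrow> real)
      \<Rightarrow> real \<Rightarrow> complex set" where
  "pseudospectrum D t T w \<epsilon> =
     (\<Union>\<Delta>\<in>pert_set \<epsilon>. eigvals D (\<lambda>z. matfun t T z + pert t w \<Delta> z))"

definition sup_attained :: "real set \<Rightarrow> bool" where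
  "sup_attained A \<longleftrightarrow> (\<exists>m\<in>A. \<forall>x\<in>A. x \<le> m)"

definition max_of :: "real set \<Rightarrow> real" where
  "max_of A = (GREATEST m. m \<in> A)"

definition pseudospectral_abscissa ::
    "complex set \<Rightarrow> ('k::finite \<Rightarrow> complex \<Rightarrow> complex) \<Rightarrow> ('k \<Rightarrow> complex^'n^'n) \<Rightarrow> ('k \<Rightarrow> real)
      \<Rightarrow> real \<Rightarrow> real" where
  "pseudospectral_abscissa D t T w \<epsilon> = max_of (Re ` pseudospectrum D t T w \<epsilon>)"

abbreviation pert_eigvals ::
    "complex set \<Rightarrow> ('k::finite \<Rightarrow> complex \<Rightarrow> complex) \<Rightarrow> ('k \<Rightarrow> complex^'n^'n) \<Rightarrow> ('k \<Rightarrow> real)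
      \<Rightarrow> ('k \<Rightarrow> complex^'n^'n) \<Rightarrow> real \<Rightarrow> complex set" where
  "pert_eigvals D t T w \<Delta> \<eta> \<equiv> eigvals D (\<lambda>z. matfun t T z + \<eta> *\<^sub>R pert t w \<Delta> z)"

text \<open>\<open>U\<close> and \<open>r\<close> are an admissible choice of the interval and of the radius attached to \<open>\<mu>0\<close>.\<close>

definition tracking_nbhd ::
    "complex set \<Rightarrow> ('k::finite \<Rightarrow> complex \<Rightarrow> complex) \<Rightarrow> ('k \<Rightarrow> complex^'n^'n) \<Rightarrow> ('k \<Rightarrow> real)
      \<Rightarrow> complex \<Rightarrow> real set \<Rightarrow> real \<Rightarrow> bool" where
  "tracking_nbhd D t T w \<mu>0 U r \<longleftrightarrow>
     open U \<and> is_interval U \<and> 0 \<in> U \<and> 0 < r \<and> ball \<mu>0 r \<subseteq> D \<and>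
     (\<forall>\<Delta>\<in>pert_set 1. \<forall>\<eta>\<in>U. \<exists>z. pert_eigvals D t T w \<Delta> \<eta> \<inter> ball \<mu>0 r = {z} \<and>
        simple_eigval D (\<lambda>z. matfun t T z + \<eta> *\<^sub>R pert t w \<Delta> z) z)"

definition tracked_eigval ::
    "complex set \<Rightarrow> ('k::finite \<Rightarrow> complex \<Rightarrow> complex) \<Rightarrow> ('k \<Rightarrow> complex^'n^'n) \<Rightarrow> ('k \<Rightarrow> real)
      \<Rightarrow> real \<Rightarrow> real \<Rightarrow> ('k \<Rightarrow> complex^'n^'n) \<Rightarrow> complex \<Rightarrow> complex" where
  "tracked_eigval D t T w r \<eta> \<Delta> \<mu>0 = (THE z. z \<in> pert_eigvals D t T w \<Delta> \<eta> \<inter> ball \<mu>0 r)"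

definition tracked_abscissa ::
    "complex set \<Rightarrow> ('k::finite \<Rightarrow> complex \<Rightarrow> complex) \<Rightarrow> ('k \<Rightarrow> complex^'n^'n) \<Rightarrow> ('k \<Rightarrow> real)
      \<Rightarrow> real \<Rightarrow> real \<Rightarrow> complex \<Rightarrow> real" where
  "tracked_abscissa D t T w r \<epsilon> \<mu>0 =
     max_of ((\<lambda>\<Delta>. Re (tracked_eigval D t T w r \<epsilon> \<Delta> \<mu>0)) ` pert_set 1)"

definition tracked_abscissas ::
    "complex set \<Rightarrow> ('k::finite \<Rightarrow> complex \<Rightarrow> complex) \<Rightarrow> ('k \<Rightarrow> complex^'n^'n) \<Rightarrow> ('k \<Rightarrow> real)
      \<Rightarrow> (complex \<Rightarrow> real) \<Rightarrow> real \<Rightarrow> real set" where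
  "tracked_abscissas D t T w r \<epsilon> =
     (\<lambda>\<mu>0. tracked_abscissa D t T w (r \<mu>0) \<epsilon> \<mu>0) ` eigvals D (matfun t T)"

definition admissible ::
    "complex set \<Rightarrow> ('k::finite \<Rightarrow> complex \<Rightarrow> complex) \<Rightarrow> ('k \<Rightarrow> complex^'n^'n) \<Rightarrow> ('k \<Rightarrow> real)
      \<Rightarrow> (complex \<Rightarrow> real set) \<Rightarrow> (complex \<Rightarrow> real) \<Rightarrow> real \<Rightarrow> bool" where
  "admissible D t T w U r \<epsilon> \<longleftrightarrow>
     0 < \<epsilon> \<and>
     sup_attained (Re ` pseudospectrum D t T w \<epsilon>) \<and>
     sup_attained (tracked_abscissas D t T w r \<epsilon>) \<and>
     (\<forall>\<mu>0\<in>eigvals D (matfun t T). {0..\<epsilon>} \<subseteq> U \<mu>0)"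

text \<open>
  Some rightmost point of the pseudospectrum is the endpoint of a continuous curve of eigenvalues
  of \<open>T + \<eta> \<Delta>T\<close>, \<open>0 \<le> \<eta> \<le> \<epsilon>\<close>, in \<open>D\<close>.  This excludes that it enters \<open>D\<close> through the
  boundary or from infinity at some \<open>\<eta> \<ge> 0\<close>, in which case the pseudospectral abscissa has
  nothing to do with the eigenvalues of \<open>T\<close>: for \<open>D = {z. z \<noteq> 0}\<close>, \<open>n = 1\<close>,
  \<open>T z + \<Delta>T z = z * (z + 1) + \<delta>\<close>, the only eigenvalue of \<open>T\<close> is \<open>-1\<close>, and it is simple,
  but for every \<open>\<epsilon> > 0\<close> the maximal real part over the pseudospectrum is attained
  at the positive root of \<open>z * (z + 1) = \<epsilon>\<close>, which tends to \<open>0\<close>.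
\<close>

definition rightmost_continued ::
    "complex set \<Rightarrow> ('k::finite \<Rightarrow> complex \<Rightarrow> complex) \<Rightarrow> ('k \<Rightarrow> complex^'n^'n) \<Rightarrow> ('k \<Rightarrow> real)
      \<Rightarrow> real \<Rightarrow> bool" where
  "rightmost_continued D t T w \<epsilon> \<longleftrightarrow>
     (\<exists>\<Delta>\<in>pert_set 1. \<exists>\<gamma>. continuous_on {0..\<epsilon>} \<gamma> \<and>
        (\<forall>\<eta>\<in>{0..\<epsilon>}. \<gamma> \<eta> \<in> pert_eigvals D t T w \<Delta> \<eta>) \<and>
        Re (\<gamma> \<epsilon>) = pseudospectral_abscissa D t T w \<epsilon>)"

definition conj_vec :: "complex^'n \<Rightarrow> complex^'n" where
  "conj_vec y = (\<chi> i. cnj (y $ i))"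

text \<open>\<open>sesq y A x\<close> is the number \<open>y\<^sup>* A x\<close>.\<close>

definition sesq :: "complex^'n \<Rightarrow> complex^'n^'n \<Rightarrow> complex^'n \<Rightarrow> complex" where
  "sesq y A x = (\<Sum>i\<in>UNIV. conj_vec y $ i * (A *v x) $ i)"

definition unit_right_eigvec :: "(complex \<Rightarrow> complex^'n^'n) \<Rightarrow> complex \<Rightarrow> complex^'n \<Rightarrow> bool" where
  "unit_right_eigvec F \<mu> x \<longleftrightarrow> norm x = 1 \<and> F \<mu> *v x = 0"

definition unit_left_eigvec :: "(complex \<Rightarrow> complex^'n^'n) \<Rightarrow> complex \<Rightarrow> complex^'n \<Rightarrow> bool" where
  "unit_left_eigvec F \<mu> y \<longleftrightarrow> norm y = 1 \<and> conj_vec y v* F \<mu> = 0"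

definition mat_deriv :: "(complex \<Rightarrow> complex^'n^'n) \<Rightarrow> complex \<Rightarrow> complex^'n^'n" where
  "mat_deriv F z = (\<chi> p q. deriv (\<lambda>s. F s $ p $ q) z)"

text \<open>
  If \<open>T\<close> has infinitely many eigenvalues, this set may be bounded above without having a maximum,
  so its supremum is used; it is the maximum whenever the latter exists.
\<close>

definition first_order_abscissas ::
    "complex set \<Rightarrow> ('k::finite \<Rightarrow> complex \<Rightarrow> complex) \<Rightarrow> ('k \<Rightarrow> complex^'n^'n) \<Rightarrow> ('k \<Rightarrow> real)
      \<Rightarrow> (complex \<Rightarrow> complex^'n) \<Rightarrow> (complex \<Rightarrow> complex^'n) \<Rightarrow> real \<Rightarrow> real set" where
  "first_order_abscissas D t T w x y \<epsilon> =
     (\<lambda>\<mu>0. Re \<mu>0 + \<epsilon> * (sqrt (\<Sum>j\<in>UNIV. (w j)\<^sup>2 * (cmod (t j \<mu>0))\<^sup>2)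
        / cmod (sesq (y \<mu>0) (mat_deriv (matfun t T) \<mu>0) (x \<mu>0)))) ` eigvals D (matfun t T)"

end

theory Submission
  imports Defs
begin

text \<open>
  Multiplying the perturbation by a complex number \<open>v\<close> instead of a small real one turns every
  tracked eigenvalue into a holomorphic function of \<open>v\<close>, and this gives error terms that are uniform
  in the eigenvalue and in the perturbation.

  Fix an admissible \<open>\<rho>\<close>, an eigenvalue \<open>a\<close> of \<open>T\<close> and a perturbation \<open>B\<close> of norm at most \<open>1\<close>, written
  as a block row.  For \<open>\<bar>v\<bar> \<le> \<rho>\<close> the matrix \<open>v B\<close> has norm at most \<open>\<rho>\<close>, so \<open>T\<close> perturbed by it has exactly
  one eigenvalue \<open>\<phi> v\<close> in the disc around \<open>a\<close>, and it is simple.  By Hurwitz's theorem \<open>\<phi>\<close> is continuous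
  (\<open>unique_zero_continuous\<close>), and then it is holomorphic with
  \<open>\<phi>' 0 = - y\<^sup>* \<Delta>T(a) x / y\<^sup>* T'(a) x\<close> (\<open>implicit_deriv\<close>, \<open>eig_path_deriv_0\<close>).  Over all \<open>B\<close> of norm at most
  \<open>1\<close>, the largest real part of this number is the quotient in the theorem, which is attained at a
  matrix of rank one (\<open>sesq_block_pert_bound\<close>, \<open>sesq_block_pert_attained\<close>).

  Let \<open>M\<close> be larger than the maximum of the tracked abscissas at \<open>\<rho>\<close>.  Then \<open>Re (\<phi> v) < M\<close> on the disc of
  radius \<open>\<rho>\<close>, and a Borel-Caratheodory argument bounds the derivative of \<open>\<phi>\<close> and its second order Taylor
  remainder by multiples of \<open>M - Re a\<close> (\<open>Re_bound_imp_deriv_bound\<close>).  Hence the tracked abscissa of \<open>a\<close>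
  at \<open>\<epsilon>\<close> equals its first order approximation up to \<open>const * (M - Re a) * \<epsilon>\<^sup>2\<close>.

  There may be infinitely many eigenvalues, and \<open>M - Re a\<close> is then possibly unbounded.  But the growth of an
  abscissa is, for small \<open>\<epsilon>\<close>, also at most a small multiple of \<open>M - Re a\<close>, so an eigenvalue far to the left
  of some fixed eigenvalue \<open>s\<close> is not competing for the maximum, while for the others \<open>M - Re a\<close> is at
  most \<open>2 * (M - Re s)\<close> (\<open>Sup_close_to_max\<close>).

  The pseudospectral abscissa is at least every tracked abscissa.  Conversely, a curve of
  eigenvalues that starts at an eigenvalue \<open>a\<close> of \<open>T\<close> and leads to a rightmost point of the
  pseudospectrum stays in the disc around \<open>a\<close>: the parameters where it agrees with the tracked
  eigenvalue form a set that is both open and closed (\<open>continued_path\<close>).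
\<close>

(* Formal power series share this symbol with vectors, which makes many terms below ambiguous. *)
no_notation fps_nth (infixl "$" 75)

section \<open>Determinants with one row replaced\<close>

abbreviation cscale :: "complex \<Rightarrow> complex^'m^'n \<Rightarrow> complex^'m^'n" where
  "cscale c A \<equiv> map_matrix ((*) c) A"

lemma tendsto_det:
  fixes A :: "'a \<Rightarrow> complex^'n^'n"
  assumes "\<And>i j. ((\<lambda>v. A v $ i $ j) \<longlongrightarrow> B $ i $ j) F"
  shows "((\<lambda>v. det (A v)) \<longlongrightarrow> det B) F"
  unfolding det_def by (intro tendsto_intros assms)

lemma continuous_on_det:
  fixes A :: "'a::topological_space \<Rightarrow> complex^'n^'n"
  assumes "\<And>i j. continuous_on S (\<lambda>v. A v $ i $ j)"
  shows "continuous_on S (\<lambda>v. det (A v))"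
  unfolding det_def by (intro continuous_intros assms)

lemma holomorphic_on_det:
  fixes A :: "complex \<Rightarrow> complex^'n^'n"
  assumes "\<And>i j. (\<lambda>v. A v $ i $ j) holomorphic_on S"
  shows "(\<lambda>v. det (A v)) holomorphic_on S"
  unfolding det_def by (intro holomorphic_intros assms)

text \<open>
  As a function of \<open>u\<close> this is a linear functional.  If \<open>q v* A = 0\<close> with \<open>q $ k \<noteq> 0\<close>, then
  \<open>H \<mapsto> det_row k A (q v* H) / q $ k\<close> is the derivative of the determinant at \<open>A\<close>; it thus does the work
  of the adjugate matrix.
\<close>

definition det_row :: "'n \<Rightarrow> complex^'n^'n \<Rightarrow> complex^'n \<Rightarrow> complex" where
  "det_row k A u = det (\<chi> i. if i = k then u else A $ i)"

lemma det_row_add: "det_row k A (u + v) = det_row k A u + det_row k A v"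
  unfolding det_row_def using Determinants.det_row_add[of k "\<lambda>i. u" "\<lambda>i. v" "\<lambda>i. A $ i"] by simp

lemma det_row_scale: "det_row k A (c *s u) = c * det_row k A u"
  unfolding det_row_def using det_row_mul[of k c "\<lambda>i. u" "\<lambda>i. A $ i"] by simp

lemma det_row_left_mult: "det_row k A (q v* A) = q $ k * det A"
proof -
  have "(\<Sum>i\<in>UNIV. q $ i *s row i A) = q v* A"
    by (simp add: vec_eq_iff vector_matrix_mult_def row_def mult.commute)
  moreover have "row i A = A $ i" for i
    by (simp add: row_def)
  ultimately show ?thesis
    using cramer_lemma_transpose[of k q A] by (simp add: det_row_def cong: if_cong)
qed

lemma tendsto_det_row:
  fixes A :: "'a \<Rightarrow> complex^'n^'n"
  assumes "\<And>i j. ((\<lambda>v. A v $ i $ j) \<longlongrightarrow> B $ i $ j) F"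
    and "\<And>j. ((\<lambda>v. u v $ j) \<longlongrightarrow> b $ j) F"
  shows "((\<lambda>v. det_row k (A v) (u v)) \<longlongrightarrow> det_row k B b) F"
  unfolding det_row_def by (rule tendsto_det) (use assms in auto)

text \<open>
  All rows of the modified matrix are orthogonal to \<open>x\<close>, the new one by the last assumption.
\<close>

lemma det_row_eq_0:
  fixes A :: "complex^'n^'n"
  assumes "A *v x = 0" "x \<noteq> 0" "(\<Sum>j\<in>UNIV. u $ j * x $ j) = 0"
  shows "det_row k A u = 0"
proof -
  let ?B = "(\<chi> i. if i = k then u else A $ i) :: complex^'n^'n"
  have "?B *v x = 0"
    using assms(1,3) by (auto simp: vec_eq_iff matrix_vector_mult_def)
  hence "\<not> invertible ?B"
    using assms(2) by (metis matrix_left_invertible_ker invertible_left_inverse)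
  thus ?thesis
    by (simp add: det_row_def invertible_det_nz)
qed

text \<open>
  By the preceding lemma the functional \<open>det_row k A\<close> vanishes on the hyperplane orthogonal to \<open>x\<close>, so it is a
  multiple of the pairing with \<open>x\<close>.  The cross-multiplied form avoids naming the factor.
\<close>

lemma det_row_cross:
  assumes "A *v x = 0" "x \<noteq> 0"
  shows "det_row k A u * (\<Sum>j\<in>UNIV. u' $ j * x $ j) = det_row k A u' * (\<Sum>j\<in>UNIV. u $ j * x $ j)"
proof -
  define d where "d u = (\<Sum>j\<in>UNIV. u $ j * x $ j)" for u
  have "d (a *s u + b *s u') = a * d u + b * d u'" for a b
    by (simp add: d_def sum.distrib sum_distrib_left algebra_simps)
  from this[of "d u'" "- d u"] have "d (d u' *s u + (- d u) *s u') = 0"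
    by simp
  hence "det_row k A (d u' *s u + (- d u) *s u') = 0"
    by (intro det_row_eq_0[OF assms]) (simp only: d_def)
  hence "d u' * det_row k A u + (- d u) * det_row k A u' = 0"
    by (simp only: det_row_add det_row_scale)
  hence "det_row k A u * d u' = det_row k A u' * d u"
    by (simp add: mult.commute)
  thus ?thesis
    by (simp only: d_def)
qed

lemma ex_left_kernel:
  fixes A :: "complex^'n^'n"
  assumes "det A = 0"
  obtains q k where "q v* A = 0" "q $ k \<noteq> 0"
proof -
  have "det (transpose A) = 0" using assms by (simp add: det_transpose)
  hence "\<not> invertible (transpose A)" by (simp add: invertible_det_nz)
  then obtain q where "transpose A *v q = 0" "q \<noteq> 0"
    by (metis matrix_left_invertible_ker invertible_left_inverse)
  moreover from \<open>q \<noteq> 0\<close> obtain k where "q $ k \<noteq> 0"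
    by (auto simp: vec_eq_iff)
  ultimately show ?thesis
    using that by (metis transpose_transpose transpose_matrix_vector)
qed

section \<open>Differentiating an implicitly defined eigenvalue\<close>

text \<open>
  The difference quotient of \<open>q v* N z\<close>, completed at \<open>z0\<close> by its limit.
\<close>

definition row_slope :: "(complex \<Rightarrow> complex^'n^'n) \<Rightarrow> complex^'n \<Rightarrow> complex \<Rightarrow> complex \<Rightarrow> complex^'n" where
  "row_slope N q z0 z =
     (if z = z0 then q v* mat_deriv N z0
      else inverse (z - z0) *s (q v* N z - q v* N z0))"

lemma row_slope_eq: "(z - z0) *s row_slope N q z0 z = q v* N z - q v* N z0"
  by (cases "z = z0") (simp_all add: row_slope_def vector_smult_assoc)

lemma row_slope_tendsto:
  assumes "open S" "z0 \<in> S" and "\<And>i j. (\<lambda>z. N z $ i $ j) holomorphic_on S"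
  shows "(\<lambda>z. row_slope N q z0 z $ j) \<midarrow>z0\<rightarrow> row_slope N q z0 z0 $ j"
proof -
  have "((\<lambda>z. N z $ i $ j) has_field_derivative mat_deriv N z0 $ i $ j) (at z0)" for i
    using holomorphic_derivI[OF assms(3,1,2)] by (simp add: mat_deriv_def)
  hence "(\<lambda>z. \<Sum>i\<in>UNIV. q $ i * ((N z $ i $ j - N z0 $ i $ j) / (z - z0)))
      \<midarrow>z0\<rightarrow> (\<Sum>i\<in>UNIV. q $ i * mat_deriv N z0 $ i $ j)"
    by (intro tendsto_intros) (simp add: has_field_derivative_iff)
  moreover have "\<forall>\<^sub>F z in at z0.
      (\<Sum>i\<in>UNIV. q $ i * ((N z $ i $ j - N z0 $ i $ j) / (z - z0))) = row_slope N q z0 z $ j"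
    unfolding eventually_at_filter
  proof (rule always_eventually, intro allI impI)
    fix z assume "z \<noteq> z0"
    hence "row_slope N q z0 z $ j
        = inverse (z - z0) * (\<Sum>i\<in>UNIV. q $ i * N z $ i $ j - q $ i * N z0 $ i $ j)"
      by (simp add: row_slope_def vector_matrix_mult_def sum_subtractf mult.commute right_diff_distrib)
    also have "\<dots> = (\<Sum>i\<in>UNIV. q $ i * ((N z $ i $ j - N z0 $ i $ j) / (z - z0)))"
      unfolding sum_distrib_left
      by (rule sum.cong) (simp_all add: divide_inverse algebra_simps)
    finally show "(\<Sum>i\<in>UNIV. q $ i * ((N z $ i $ j - N z0 $ i $ j) / (z - z0))) = row_slope N q z0 z $ j" ..
  qed
  ultimately have "(\<lambda>z. row_slope N q z0 z $ j) \<midarrow>z0\<rightarrow> (\<Sum>i\<in>UNIV. q $ i * mat_deriv N z0 $ i $ j)"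
    by (rule Lim_transform_eventually)
  thus ?thesis
    by (simp add: row_slope_def vector_matrix_mult_def mult.commute)
qed

lemma entry_isCont:
  assumes "open S" "z0 \<in> S" and "\<And>i j. (\<lambda>z. N z $ i $ j) holomorphic_on S"
  shows "isCont (\<lambda>z. N z $ i $ j) z0"
  using assms by (meson continuous_on_eq_continuous_at holomorphic_on_imp_continuous_on)

text \<open>
  If \<open>q v* N z0 = 0\<close>, then the row \<open>q v* N z\<close> is divisible by \<open>z - z0\<close>.  Dividing it out of
  \<open>q $ k * det (N z) = det_row k (N z) (q v* N z)\<close> and letting \<open>z\<close> tend to \<open>z0\<close> gives the derivative.
\<close>

lemma det_row_deriv:
  assumes S: "open S" "z0 \<in> S" and N: "\<And>i j. (\<lambda>z. N z $ i $ j) holomorphic_on S"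
    and q: "q v* N z0 = 0"
    and nz: "q $ k \<noteq> 0"
  shows "det_row k (N z0) (q v* mat_deriv N z0) = q $ k * deriv (\<lambda>z. det (N z)) z0"
proof -
  have d0: "det (N z0) = 0"
    using det_row_left_mult[of k "N z0" q] nz det_row_scale[of k "N z0" 0 0] by (simp add: q)
  have "((\<lambda>z. det (N z)) has_field_derivative deriv (\<lambda>z. det (N z)) z0) (at z0)"
    using holomorphic_derivI[OF holomorphic_on_det[OF N] S] by simp
  hence "(\<lambda>z. q $ k * (det (N z) / (z - z0))) \<midarrow>z0\<rightarrow> q $ k * deriv (\<lambda>z. det (N z)) z0"
    by (intro tendsto_intros) (simp add: has_field_derivative_iff d0)
  moreover have "(\<lambda>z. det_row k (N z) (row_slope N q z0 z)) \<midarrow>z0\<rightarrow> det_row k (N z0) (row_slope N q z0 z0)"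
    by (intro tendsto_det_row row_slope_tendsto[OF S N] isContD entry_isCont[OF S N])
  moreover have ev: "\<forall>\<^sub>F z in at z0. det_row k (N z) (row_slope N q z0 z) = q $ k * (det (N z) / (z - z0))"
    unfolding eventually_at_filter
  proof (rule always_eventually, intro allI impI)
    fix z assume "z \<noteq> z0"
    have "q $ k * det (N z) = (z - z0) * det_row k (N z) (row_slope N q z0 z)"
      unfolding det_row_left_mult[symmetric] det_row_scale[symmetric] row_slope_eq by (simp add: q)
    thus "det_row k (N z) (row_slope N q z0 z) = q $ k * (det (N z) / (z - z0))"
      using \<open>z \<noteq> z0\<close> by (simp add: field_simps)
  qed
  ultimately have "det_row k (N z0) (row_slope N q z0 z0) = q $ k * deriv (\<lambda>z. det (N z)) z0"
    using Lim_transform_eventually[OF _ ev] LIM_unique by blast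
  thus ?thesis by (simp add: row_slope_def)
qed

text \<open>
  An implicit function theorem in which continuity of the solution \<open>\<phi>\<close> is given.  Put \<open>M v = N z + (v - v0) E z\<close>
  with \<open>z = \<phi> v\<close>.  The row \<open>q v* M v\<close> splits into \<open>z - z0\<close> times a difference quotient and \<open>v - v0\<close> times
  \<open>q v* E z\<close>, and it replaces row \<open>k\<close> in a determinant that vanishes.  Linearity in that row therefore
  expresses \<open>(\<phi> v - z0) / (v - v0)\<close> as a quotient of two determinants that have limits.
\<close>

lemma implicit_deriv:
  fixes N E :: "complex \<Rightarrow> complex^'n^'n"
  assumes S: "open S" "z0 \<in> S" and N: "\<And>i j. (\<lambda>z. N z $ i $ j) holomorphic_on S"
    and E: "\<And>i j. isCont (\<lambda>z. E z $ i $ j) z0"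
    and q: "q v* N z0 = 0"
    and \<phi>: "isCont \<phi> v0" "\<phi> v0 = z0"
    and zero: "\<forall>\<^sub>F v in at v0. det (N (\<phi> v) + cscale (v - v0) (E (\<phi> v))) = 0"
    and nz: "det_row k (N z0) (q v* mat_deriv N z0) \<noteq> 0"
  shows "(\<phi> has_field_derivative
           - det_row k (N z0) (q v* E z0) / det_row k (N z0) (q v* mat_deriv N z0)) (at v0)"
proof -
  define M where "M v = N (\<phi> v) + cscale (v - v0) (E (\<phi> v))" for v
  define \<alpha> where "\<alpha> v = det_row k (M v) (q v* E (\<phi> v))" for v
  define \<beta> where "\<beta> v = det_row k (M v) (row_slope N q z0 (\<phi> v))" for v
  have comp: "(\<lambda>v. f (\<phi> v)) \<midarrow>v0\<rightarrow> f z0" if "isCont f z0" for f :: "complex \<Rightarrow> complex"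
  proof (rule isCont_tendsto_compose[OF that])
    show "\<phi> \<midarrow>v0\<rightarrow> z0" using \<phi> by (simp add: isCont_def)
  qed
  have M_lim: "(\<lambda>v. M v $ i $ j) \<midarrow>v0\<rightarrow> N z0 $ i $ j" for i j
  proof -
    have "(\<lambda>v. N (\<phi> v) $ i $ j + (v - v0) * E (\<phi> v) $ i $ j) \<midarrow>v0\<rightarrow> N z0 $ i $ j + (v0 - v0) * E z0 $ i $ j"
      by (intro tendsto_intros comp[of "\<lambda>z. N z $ i $ j"] comp[of "\<lambda>z. E z $ i $ j"] E entry_isCont[OF S N])
    thus ?thesis by (simp add: M_def)
  qed
  have \<alpha>_lim: "\<alpha> \<midarrow>v0\<rightarrow> det_row k (N z0) (q v* E z0)"
    unfolding \<alpha>_def vector_matrix_mult_def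
    by (intro tendsto_det_row M_lim) (simp, intro tendsto_intros comp E)
  have "isCont (\<lambda>z. row_slope N q z0 z $ j) z0" for j
    using row_slope_tendsto[OF S N] by (simp add: isCont_def)
  hence \<beta>_lim: "\<beta> \<midarrow>v0\<rightarrow> det_row k (N z0) (q v* mat_deriv N z0)"
    unfolding \<beta>_def
    using comp[of "\<lambda>z. row_slope N q z0 z $ j" for j]
    by (intro tendsto_det_row M_lim) (simp add: row_slope_def[of N q z0 z0])
  have "\<forall>\<^sub>F v in at v0. \<beta> v \<noteq> 0"
    using \<beta>_lim nz by (rule tendsto_imp_eventually_ne)
  hence ev: "\<forall>\<^sub>F v in at v0. - \<alpha> v / \<beta> v = (\<phi> v - \<phi> v0) / (v - v0)"
    using zero unfolding eventually_at_filter
  proof eventually_elim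
    case (elim v)
    show ?case
    proof (intro impI)
      assume "v \<noteq> v0"
      have "q v* cscale c A = c *s (q v* A)" for c and A :: "complex^'n^'n"
        by (simp add: vec_eq_iff vector_matrix_mult_def sum_distrib_left mult_ac)
      moreover have "q v* (A + B) = q v* A + q v* B" for A B :: "complex^'n^'n"
        by (rule vector_matrix_mult_add_rdistrib)
      ultimately have "q v* M v = (\<phi> v - z0) *s row_slope N q z0 (\<phi> v) + (v - v0) *s (q v* E (\<phi> v))"
        unfolding row_slope_eq by (simp add: M_def q)
      moreover have "det_row k (M v) (q v* M v) = 0"
        using elim(2) \<open>v \<noteq> v0\<close> by (simp add: det_row_left_mult M_def)
      ultimately have "(\<phi> v - z0) * \<beta> v + (v - v0) * \<alpha> v = 0"
        by (simp only: det_row_add det_row_scale \<alpha>_def \<beta>_def)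
      hence "- \<alpha> v * (v - v0) = (\<phi> v - \<phi> v0) * \<beta> v"
        by (simp add: \<phi>(2) mult.commute add_eq_0_iff)
      moreover have "\<beta> v \<noteq> 0" "v - v0 \<noteq> 0"
        using elim(1) \<open>v \<noteq> v0\<close> by auto
      ultimately have "\<phi> v - \<phi> v0 = - \<alpha> v * (v - v0) / \<beta> v" "v - v0 \<noteq> 0"
        by simp_all
      thus "- \<alpha> v / \<beta> v = (\<phi> v - \<phi> v0) / (v - v0)"
        by simp
    qed
  qed
  have "(\<lambda>v. - \<alpha> v / \<beta> v) \<midarrow>v0\<rightarrow>
      - det_row k (N z0) (q v* E z0) / det_row k (N z0) (q v* mat_deriv N z0)"
    by (intro tendsto_intros \<alpha>_lim \<beta>_lim nz)
  thus ?thesis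
    unfolding has_field_derivative_iff by (rule Lim_transform_eventually[OF _ ev])
qed

section \<open>Holomorphic functions: zeros and one-sided bounds\<close>

lemma simple_zero_deriv:
  assumes f: "f holomorphic_on S" "open S" "connected S" "z \<in> S"
    and nz: "\<exists>w\<in>S. f w \<noteq> 0" and ord: "zorder f z = 1"
  shows "deriv f z \<noteq> 0"
proof -
  obtain g \<rho> where \<rho>: "\<rho> > 0" and g: "g holomorphic_on cball z \<rho>"
    and fg: "\<And>w. w \<in> cball z \<rho> \<Longrightarrow> f w = g w * (w - z) \<and> g w \<noteq> 0"
    using zorder_exist_zero[OF f nz] ord by auto
  have "(g has_field_derivative deriv g z) (at z)"
    using g \<rho> by (meson ball_subset_cball centre_in_ball holomorphic_derivI holomorphic_on_subset open_ball)
  hence "((\<lambda>w. g w * (w - z)) has_field_derivative g z) (at z)"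
    by (auto intro!: derivative_eq_intros)
  hence "(f has_field_derivative g z) (at z within UNIV)"
    by (rule has_field_derivative_transform_within[OF _ \<rho>]) (auto simp: fg dist_commute)
  thus ?thesis
    using fg[of z] \<rho> DERIV_imp_deriv[of f "g z" z] by auto
qed

text \<open>
  If \<open>\<phi>\<close> jumped at \<open>p\<close>, then along some sequence of parameters tending to \<open>p\<close> the functions would have
  no zero in a fixed disc around \<open>\<phi> p\<close>.  By Hurwitz's theorem their limit \<open>F p\<close> would have none either, although it
  vanishes at \<open>\<phi> p\<close>.
\<close>

lemma unique_zero_continuous:
  fixes F :: "'p::metric_space \<Rightarrow> complex \<Rightarrow> complex"
  assumes cont: "continuous_on (P \<times> ball a r) (\<lambda>(p, z). F p z)"
    and hol: "\<And>p. p \<in> P \<Longrightarrow> F p holomorphic_on ball a r"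
    and \<phi>: "\<And>p. p \<in> P \<Longrightarrow> \<phi> p \<in> ball a r"
    and zero: "\<And>p z. p \<in> P \<Longrightarrow> z \<in> ball a r \<Longrightarrow> F p z = 0 \<longleftrightarrow> z = \<phi> p"
  shows "continuous_on P \<phi>"
  unfolding continuous_on_sequentially
proof (intro allI ballI impI, elim conjE)
  fix u p assume p: "p \<in> P" and uP: "\<forall>n. u n \<in> P" and u: "u \<longlonglongrightarrow> p"
  show "(\<phi> \<circ> u) \<longlonglongrightarrow> \<phi> p"
  proof (rule ccontr)
    assume "\<not> (\<phi> \<circ> u) \<longlonglongrightarrow> \<phi> p"
    then obtain e where e: "e > 0" "\<exists>\<^sub>F n in sequentially. \<not> dist (\<phi> (u n)) (\<phi> p) < e"
      unfolding tendsto_iff frequently_def by auto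
    then obtain s :: "nat \<Rightarrow> nat" where s: "strict_mono s" "\<And>n. \<not> dist (\<phi> (u (s n))) (\<phi> p) < e"
    proof -
      have "infinite {n. \<not> dist (\<phi> (u n)) (\<phi> p) < e}"
        using e(2) by (simp add: frequently_cofinite[symmetric] cofinite_eq_sequentially)
      then obtain s :: "nat \<Rightarrow> nat" where "strict_mono s" "\<forall>n. s n \<in> {n. \<not> dist (\<phi> (u n)) (\<phi> p) < e}"
        using infinite_enumerate by blast
      thus thesis using that by auto
    qed
    have us: "(\<lambda>n. u (s n)) \<longlonglongrightarrow> p"
      using LIMSEQ_subseq_LIMSEQ[OF u s(1)] by (simp add: o_def)
    obtain d where d: "d > 0" "ball (\<phi> p) d \<subseteq> ball a r"
      using \<phi>[OF p] open_ball openE by blast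
    define S where "S = ball (\<phi> p) (min e d)"
    have S: "open S" "connected S" "\<phi> p \<in> S" "S \<subseteq> ball a r"
      using e d by (auto simp: S_def)
    have "F p (\<phi> p) \<noteq> 0"
    proof (rule Hurwitz_no_zeros[of S "\<lambda>n. F (u (s n))" "F p"])
      show "F (u (s n)) holomorphic_on S" for n
        using hol uP S(4) holomorphic_on_subset by blast
      show "F p holomorphic_on S"
        using hol p S(4) holomorphic_on_subset by blast
      show "uniform_limit K (\<lambda>n. F (u (s n))) (F p) sequentially" if K: "compact K" "K \<subseteq> S" for K
        unfolding uniform_limit_iff
      proof (intro allI impI)
        fix \<epsilon> :: real assume "\<epsilon> > 0"
        have "continuous_on (P \<times> K) (\<lambda>(p, z). F p z)"
          using cont K S(4) by (meson Sigma_mono continuous_on_subset order_refl order_trans)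
        then obtain X0 where X0: "p \<in> X0" "open X0"
          "\<forall>x\<in>X0 \<inter> P. \<forall>t\<in>K. dist (F x t) (F p t) \<le> \<epsilon>/2"
          using continuous_on_prod_compactE[OF _ K(1) p, of "\<lambda>(p, z). F p z" "\<epsilon>/2"] \<open>\<epsilon> > 0\<close> by auto
        have "\<forall>\<^sub>F n in sequentially. u (s n) \<in> X0"
          by (rule topological_tendstoD[OF us X0(2,1)])
        thus "\<forall>\<^sub>F n in sequentially. \<forall>x\<in>K. dist (F (u (s n)) x) (F p x) < \<epsilon>"
        proof eventually_elim
          case (elim n)
          show ?case
          proof
            fix x assume "x \<in> K"
            hence "dist (F (u (s n)) x) (F p x) \<le> \<epsilon>/2" using X0(3) uP elim by auto
            thus "dist (F (u (s n)) x) (F p x) < \<epsilon>" using \<open>\<epsilon> > 0\<close> by simp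
          qed
        qed
      qed
      show "\<not> F p constant_on S"
      proof
        assume "F p constant_on S"
        hence "F p z = 0" if "z \<in> S" for z
          using that S(3,4) zero[OF p \<phi>[OF p]] unfolding constant_on_def by metis
        hence "S \<subseteq> {\<phi> p}"
          using zero[OF p] S(4) by blast
        hence "S = {\<phi> p}"
          using S(3) by blast
        thus False
          using S(1) by (metis not_open_singleton)
      qed
      show "F (u (s n)) z \<noteq> 0" if "z \<in> S" for n z
        using that s(2)[of n] zero[of "u (s n)" z] uP S(4) by (auto simp: S_def dist_commute)
    qed (use S in auto)
    thus False
      using zero[OF p \<phi>[OF p]] by simp
  qed
qed

text \<open>
  The Borel-Caratheodory inequality.  With \<open>A = M - Re (f 0)\<close>, the map \<open>h \<mapsto> h / (2 * A - h)\<close> sends the half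
  plane \<open>Re h < A\<close> to the unit disc and fixes \<open>0\<close>, so the Schwarz lemma applies to its composition with
  \<open>f - f 0\<close>.
\<close>

lemma Re_bound_imp_norm_bound:
  assumes hol: "f holomorphic_on ball 0 R" and R: "R > 0"
    and bound: "\<And>v. v \<in> ball 0 R \<Longrightarrow> Re (f v) < M"
    and v: "cmod v \<le> R / 2"
  shows "cmod (f v - f 0) \<le> 2 * (M - Re (f 0))"
proof -
  define A where "A = M - Re (f 0)"
  have A: "A > 0"
    using bound[of 0] R by (simp add: A_def)
  define h where "h \<xi> = f (R * \<xi>) - f 0" for \<xi> :: complex
  have dom: "of_real R * \<xi> \<in> ball 0 R" if "cmod \<xi> < 1" for \<xi> :: complex
    using that R by (simp add: norm_mult)
  have hol_h: "h holomorphic_on ball 0 1"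
    unfolding h_def
    by (intro holomorphic_intros holomorphic_on_compose_gen[OF _ hol, unfolded o_def]) (use dom in auto)
  have lt: "cmod (h \<xi>) < cmod (2 * A - h \<xi>)" if "cmod \<xi> < 1" for \<xi>
  proof -
    have "Re (h \<xi>) < A"
      using bound[OF dom[OF that]] by (simp add: h_def A_def)
    hence "A * Re (h \<xi>) < A * A" using A by simp
    hence "(cmod (h \<xi>))\<^sup>2 < (cmod (2 * A - h \<xi>))\<^sup>2"
      unfolding cmod_power2 by (simp add: power2_eq_square algebra_simps)
    thus ?thesis by (rule power2_less_imp_less) simp
  qed
  have le: "cmod (h \<xi>) \<le> cmod \<xi> * cmod (2 * A - h \<xi>)" if "cmod \<xi> < 1" for \<xi>
  proof -
    have nz: "2 * A - h \<xi> \<noteq> 0" if "cmod \<xi> < 1" for \<xi>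
      using lt[OF that] by auto
    have "cmod (h \<xi> / (2 * A - h \<xi>)) \<le> cmod \<xi>"
    proof (rule Schwarz_Lemma(1)[where f = "\<lambda>\<xi>. h \<xi> / (2 * A - h \<xi>)"])
      show "(\<lambda>\<xi>. h \<xi> / (2 * A - h \<xi>)) holomorphic_on ball 0 1"
        by (intro holomorphic_intros hol_h) (use nz in auto)
      show "cmod (h z / (2 * A - h z)) < 1" if "cmod z < 1" for z
        using lt[OF that] nz[OF that] by (simp add: norm_divide)
    qed (use that in \<open>simp_all add: h_def\<close>)
    thus ?thesis
      using nz[OF that] by (simp add: norm_divide field_simps)
  qed
  define \<xi> where "\<xi> = v / R"
  have \<xi>: "cmod \<xi> \<le> 1/2" and hv: "h \<xi> = f v - f 0"
    using v R by (simp_all add: \<xi>_def h_def norm_divide field_simps)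
  have "cmod (h \<xi>) \<le> cmod \<xi> * cmod (2 * A - h \<xi>)"
    by (rule le) (use \<xi> in simp)
  also have "\<dots> \<le> 1/2 * (2 * A + cmod (h \<xi>))"
    using \<xi> A norm_triangle_ineq4[of "2 * of_real A" "h \<xi>"] by (intro mult_mono) (auto simp: norm_mult)
  finally have "cmod (h \<xi>) \<le> 2 * A" by simp
  thus ?thesis by (simp add: hv A_def)
qed

text \<open>
  Cauchy estimates on discs inside \<open>cball 0 (R/2)\<close>, where \<open>f\<close> differs from \<open>f 0\<close> by less than
  \<open>3 * (M - Re (f 0))\<close>.  The second derivative on \<open>cball 0 (R/4)\<close> is estimated with discs of radius \<open>R/4\<close>, whence
  the constant \<open>96 = 2 * 3 * 4\<^sup>2\<close>.
\<close>

lemma Re_bound_imp_deriv_bound: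
  assumes hol: "f holomorphic_on ball 0 R" and R: "R > 0"
    and bound: "\<And>v. v \<in> ball 0 R \<Longrightarrow> Re (f v) < M"
  shows "cmod (deriv f 0) \<le> 6 * (M - Re (f 0)) / R"
    and "cmod v \<le> R / 4 \<Longrightarrow>
      cmod (f v - f 0 - deriv f 0 * v) \<le> 96 * (M - Re (f 0)) / R\<^sup>2 * (cmod v)\<^sup>2"
proof -
  define A where "A = M - Re (f 0)"
  have A: "A > 0"
    using bound[of 0] R by (simp add: A_def)
  have in_ball: "f v \<in> ball (f 0) (3 * A)" if "cmod v \<le> R/2" for v
    using Re_bound_imp_norm_bound[OF hol R bound that] A
    by (simp add: dist_norm norm_minus_commute A_def)
  have Cauchy: "cmod ((deriv ^^ n) f c) \<le> fact n * (3 * A) / \<rho> ^ n"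
    if "0 < n" "0 < \<rho>" "cmod c + \<rho> \<le> R/2" for n \<rho> c
  proof (rule Cauchy_higher_deriv_bound[where y = "f 0"])
    have sub: "w \<in> cball c \<rho> \<Longrightarrow> cmod w \<le> R/2" for w
      using that(3) norm_triangle_ineq2[of w c] by (simp add: dist_norm norm_minus_commute)
    have "cball c \<rho> \<subseteq> ball 0 R"
      using sub R by (force simp: subset_iff)
    thus "f holomorphic_on ball c \<rho>" "continuous_on (cball c \<rho>) f"
      using hol by (meson ball_subset_cball holomorphic_on_subset order_trans,
        meson hol holomorphic_on_imp_continuous_on holomorphic_on_subset)
    show "f w \<in> ball (f 0) (3 * A)" if "w \<in> ball c \<rho>" for w
      using that by (intro in_ball sub) simp
  qed (use that in auto)
  have "cmod ((deriv ^^ 1) f 0) \<le> fact 1 * (3 * A) / (R/2) ^ 1"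
    by (rule Cauchy) (use R in auto)
  thus "cmod (deriv f 0) \<le> 6 * (M - Re (f 0)) / R"
    by (simp add: A_def)
  show "cmod (f v - f 0 - deriv f 0 * v) \<le> 96 * (M - Re (f 0)) / R\<^sup>2 * (cmod v)\<^sup>2"
    if v: "cmod v \<le> R / 4"
  proof -
    have "cmod ((deriv ^^ 0) f v - (\<Sum>i\<le>1. (deriv ^^ i) f 0 * (v - 0) ^ i / fact i))
        \<le> 96 * A / R\<^sup>2 * cmod (v - 0) ^ Suc 1 / fact 1"
    proof (rule complex_Taylor[where S = "cball 0 (R/4)" and f = "\<lambda>i. (deriv ^^ i) f"])
      fix i and x :: complex assume "x \<in> cball 0 (R/4)"
      hence x: "x \<in> ball 0 R" using R by simp
      have "(deriv ^^ i) f holomorphic_on ball 0 R"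
        by (intro holomorphic_higher_deriv hol) simp
      from holomorphic_derivI[OF this open_ball x]
      show "((deriv ^^ i) f has_field_derivative (deriv ^^ Suc i) f x) (at x within cball 0 (R/4))"
        by (simp add: has_field_derivative_at_within)
    next
      fix x :: complex assume "x \<in> cball 0 (R/4)"
      hence "cmod ((deriv ^^ 2) f x) \<le> fact 2 * (3 * A) / (R/4) ^ 2"
        by (intro Cauchy) (use R in auto)
      thus "cmod ((deriv ^^ Suc 1) f x) \<le> 96 * A / R\<^sup>2"
        by (simp add: power_divide numeral_2_eq_2)
    qed (use R v in auto)
    thus ?thesis
      by (simp add: A_def power2_eq_square algebra_simps)
  qed
qed

section \<open>The spectral norm\<close>

lemma linear_matrix_vector_mult: "linear ((*v) (A :: complex^'m^'n))"
  by (rule linearI)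
     (rule matrix_vector_right_distrib, simp add: vec_eq_iff matrix_vector_mult_def scaleR_sum_right)

lemma spectral_norm_bound: "norm (A *v u) \<le> spectral_norm A * norm u"
  unfolding spectral_norm_def
  by (rule onorm) (use linear_matrix_vector_mult linear_conv_bounded_linear in blast)

lemma spectral_norm_leI: "(\<And>u. norm (A *v u) \<le> c * norm u) \<Longrightarrow> spectral_norm A \<le> c"
  unfolding spectral_norm_def by (rule onorm_le)

lemma spectral_norm_nonneg: "0 \<le> spectral_norm A"
  unfolding spectral_norm_def
  by (rule onorm_pos_le) (use linear_matrix_vector_mult linear_conv_bounded_linear in blast)

lemma norm_vec_scale: "norm (c *s (u :: complex^'n)) = cmod c * norm u"
  unfolding norm_vec_def vector_smult_component norm_mult by (rule L2_set_right_distrib[symmetric]) simp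

lemma cscale_mult_vec: "cscale c A *v u = c *s (A *v u)"
  by (simp add: vec_eq_iff matrix_vector_mult_def sum_distrib_left mult.assoc)

lemma spectral_norm_cscale: "spectral_norm (cscale c A) \<le> cmod c * spectral_norm A"
  by (rule spectral_norm_leI)
     (use spectral_norm_bound[of A] in \<open>simp add: cscale_mult_vec norm_vec_scale mult.assoc mult_left_mono\<close>)

lemma spectral_ball_eq_scaled:
  assumes "0 < c"
  shows "{A :: complex^'m^'n. spectral_norm A \<le> c} = cscale (of_real c) ` {A. spectral_norm A \<le> 1}"
proof (intro equalityI subsetI)
  fix A :: "complex^'m^'n" assume A: "A \<in> {A. spectral_norm A \<le> c}"
  have "spectral_norm (cscale (inverse (of_real c)) A) \<le> inverse c * spectral_norm A"
    using spectral_norm_cscale[of "inverse (of_real c)" A] assms by (simp add: norm_inverse)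
  also have "\<dots> \<le> inverse c * c"
    using A assms by (intro mult_left_mono) auto
  finally have "cscale (inverse (of_real c)) A \<in> {A. spectral_norm A \<le> 1}"
    using assms by simp
  moreover have "A = cscale (of_real c) (cscale (inverse (of_real c)) A)"
    unfolding vec_eq_iff nth_map_matrix using assms by simp
  ultimately show "A \<in> cscale (of_real c) ` {A. spectral_norm A \<le> 1}"
    by (rule rev_image_eqI)
next
  fix A :: "complex^'m^'n" assume "A \<in> cscale (of_real c) ` {A. spectral_norm A \<le> 1}"
  then obtain B where B: "spectral_norm B \<le> 1" "A = cscale (of_real c) B" by blast
  have "spectral_norm A \<le> c * spectral_norm B"
    using spectral_norm_cscale[of "of_real c" B] assms B(2) by simp
  also have "\<dots> \<le> c * 1"
    using B(1) assms by (intro mult_left_mono) auto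
  finally show "A \<in> {A. spectral_norm A \<le> c}" by simp
qed

lemma compact_spectral_ball: "compact {A :: complex^'m^'n. spectral_norm A \<le> c}"
proof -
  let ?S = "{A :: complex^'m^'n. spectral_norm A \<le> c}"
  have eq: "?S = (\<Inter>u. {A. norm (A *v u) \<le> c * norm u})"
  proof safe
    fix A :: "complex^'m^'n" and u assume "spectral_norm A \<le> c"
    thus "norm (A *v u) \<le> c * norm u"
      using spectral_norm_bound[of A u] by (meson mult_right_mono norm_ge_zero order_trans)
  next
    fix A :: "complex^'m^'n" assume "A \<in> (\<Inter>u. {A. norm (A *v u) \<le> c * norm u})"
    thus "spectral_norm A \<le> c"
      by (intro spectral_norm_leI) blast
  qed
  have "closed ?S"
    unfolding eq norm_vec_def[of "_ *v _"] L2_set_def matrix_vector_mult_def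
    by (intro closed_INT ballI closed_Collect_le) (simp_all, intro continuous_intros)
  moreover have "bounded ?S"
    unfolding bounded_iff
  proof (intro exI ballI)
    fix A :: "complex^'m^'n" assume A: "A \<in> ?S"
    have entry: "cmod (A $ p $ e) \<le> c" for p e
    proof -
      have "A $ p $ e = (A *v axis e 1) $ p"
        by (simp add: matrix_vector_mult_def axis_def if_distrib cong: if_cong)
      hence "cmod (A $ p $ e) \<le> norm (A *v axis e 1)"
        by (simp add: Finite_Cartesian_Product.norm_nth_le)
      also have "\<dots> \<le> spectral_norm A * norm (axis e 1 :: complex^'m)"
        by (rule spectral_norm_bound)
      also have "\<dots> \<le> c" using A by simp
      finally show ?thesis .
    qed
    have "norm A \<le> (\<Sum>p\<in>UNIV. norm (A $ p))"
      unfolding norm_vec_def[of A] by (rule L2_set_le_sum) simp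
    also have "\<dots> \<le> (\<Sum>p\<in>UNIV. \<Sum>e\<in>UNIV. cmod (A $ p $ e))"
      unfolding norm_vec_def[of "A $ _"] by (intro sum_mono L2_set_le_sum) simp
    also have "\<dots> \<le> (\<Sum>p\<in>(UNIV::'n set). \<Sum>e\<in>(UNIV::'m set). c)"
      by (intro sum_mono entry)
    finally show "norm A \<le> (\<Sum>p\<in>(UNIV::'n set). \<Sum>e\<in>(UNIV::'m set). c)" .
  qed
  ultimately show ?thesis by (simp add: compact_eq_bounded_closed)
qed

section \<open>Perturbations as block rows\<close>

text \<open>
  The perturbation as a function of the block row \<open>[\<Delta>T\<^sub>1 \<dots> \<Delta>T\<^sub>\<kappa>]\<close>.  Block rows form a Euclidean space, in
  which the admissible perturbations are a compact ball.
\<close>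

definition block_pert ::
    "('k::finite \<Rightarrow> complex \<Rightarrow> complex) \<Rightarrow> ('k \<Rightarrow> real) \<Rightarrow> complex^('k \<times> 'n)^'n \<Rightarrow> complex \<Rightarrow> complex^'n^'n" where
  "block_pert t w B z = (\<chi> p q. \<Sum>j\<in>UNIV. t j z * of_real (w j) * B $ p $ (j, q))"

text \<open>
  The Kronecker product of the vector of all \<open>t\<^sub>j(z) w\<^sub>j\<close> with \<open>x\<close>.  Its norm is the numerator in the first order term.
\<close>

definition weighted_vec ::
    "('k::finite \<Rightarrow> complex \<Rightarrow> complex) \<Rightarrow> ('k \<Rightarrow> real) \<Rightarrow> complex \<Rightarrow> complex^'n \<Rightarrow> complex^('k \<times> 'n)" where
  "weighted_vec t w z x = (\<chi> e. t (fst e) z * of_real (w (fst e)) * x $ snd e)"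

lemma matfun_nth: "matfun t T z $ p $ q = (\<Sum>j\<in>UNIV. t j z * T j $ p $ q)"
  by (simp add: matfun_def sum_component)

lemma pert_eq_block_pert: "pert t w \<Delta> z = block_pert t w (block_row \<Delta>) z"
  by (simp add: vec_eq_iff pert_def matfun_nth block_pert_def block_row_def)

lemma block_pert_cscale: "block_pert t w (cscale c B) z = cscale c (block_pert t w B z)"
  by (simp add: vec_eq_iff block_pert_def sum_distrib_left mult_ac)

lemma bij_block_row: "bij (block_row :: ('k::finite \<Rightarrow> complex^'n^'n) \<Rightarrow> _)"
proof (rule bijI')
  show "(block_row A = block_row B) = (A = B)" for A B :: "'k \<Rightarrow> complex^'n^'n"
    by (auto simp: block_row_def vec_eq_iff fun_eq_iff)
  show "\<exists>A. B = block_row A" for B :: "complex^('k \<times> 'n)^'n"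
    by (rule exI[of _ "\<lambda>j. \<chi> p q. B $ p $ (j, q)"]) (simp add: block_row_def vec_eq_iff)
qed

lemma block_row_image_pert_set: "block_row ` pert_set \<epsilon> = {B. spectral_norm B \<le> \<epsilon>}"
  using bij_is_surj[OF bij_block_row] by (auto simp: pert_set_def image_iff)

lemma block_pert_mult_vec: "block_pert t w B z *v x = B *v weighted_vec t w z x"
proof -
  have "(\<Sum>q\<in>UNIV. (\<Sum>j\<in>UNIV. t j z * of_real (w j) * B $ p $ (j, q)) * x $ q) =
    (\<Sum>e\<in>UNIV. B $ p $ e * (t (fst e) z * of_real (w (fst e)) * x $ snd e))" for p
  proof -
    have "(\<Sum>q\<in>UNIV. (\<Sum>j\<in>UNIV. t j z * of_real (w j) * B $ p $ (j, q)) * x $ q)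
      = (\<Sum>j\<in>UNIV. \<Sum>q\<in>UNIV. B $ p $ (j, q) * (t j z * of_real (w j) * x $ q))"
      unfolding sum_distrib_right by (subst sum.swap) (simp add: mult_ac)
    thus ?thesis
      by (simp add: sum.cartesian_product UNIV_Times_UNIV[symmetric] case_prod_beta del: UNIV_Times_UNIV)
  qed
  thus ?thesis
    by (simp add: vec_eq_iff matrix_vector_mult_def block_pert_def weighted_vec_def)
qed

lemma norm_weighted_vec:
  "norm (weighted_vec t w z x) = sqrt (\<Sum>j\<in>UNIV. (w j)\<^sup>2 * (cmod (t j z))\<^sup>2) * norm x"
proof -
  have "(\<Sum>e\<in>UNIV. (cmod (weighted_vec t w z x $ e))\<^sup>2)
     = (\<Sum>j\<in>UNIV. \<Sum>q\<in>UNIV. ((w j)\<^sup>2 * (cmod (t j z))\<^sup>2) * (cmod (x $ q))\<^sup>2)"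
    by (simp add: weighted_vec_def sum.cartesian_product case_prod_beta norm_mult power_mult_distrib mult_ac)
  also have "\<dots> = (\<Sum>j\<in>UNIV. (w j)\<^sup>2 * (cmod (t j z))\<^sup>2) * (\<Sum>q\<in>UNIV. (cmod (x $ q))\<^sup>2)"
    by (simp add: sum_product)
  finally show ?thesis
    by (simp add: norm_vec_def L2_set_def real_sqrt_mult)
qed

lemma norm_conj_vec [simp]: "norm (conj_vec y) = norm y"
  by (simp add: norm_vec_def conj_vec_def)

lemma bilinear_norm_bound:
  fixes u v :: "complex^'n"
  shows "cmod (\<Sum>i\<in>UNIV. u $ i * v $ i) \<le> norm u * norm v"
proof -
  have "cmod (\<Sum>i\<in>UNIV. u $ i * v $ i) \<le> (\<Sum>i\<in>UNIV. \<bar>cmod (u $ i)\<bar> * \<bar>cmod (v $ i)\<bar>)"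
    using norm_sum[of "\<lambda>i. u $ i * v $ i" UNIV] by (simp add: norm_mult)
  also have "\<dots> \<le> norm u * norm v"
    unfolding norm_vec_def by (rule L2_set_mult_ineq)
  finally show ?thesis .
qed

lemma conj_vec_self: "(\<Sum>i\<in>UNIV. conj_vec u $ i * u $ i) = of_real ((norm u)\<^sup>2)"
proof -
  have "(norm u)\<^sup>2 = (\<Sum>i\<in>UNIV. (cmod (u $ i))\<^sup>2)"
    by (simp add: norm_vec_def L2_set_def sum_nonneg)
  thus ?thesis
    by (simp only: of_real_sum complex_norm_square conj_vec_def vec_lambda_beta mult.commute)
qed

lemma sesq_block_pert_bound:
  assumes "spectral_norm B \<le> 1" "norm x = 1" "norm y = 1"
  shows "cmod (sesq y (block_pert t w B z) x) \<le> sqrt (\<Sum>j\<in>UNIV. (w j)\<^sup>2 * (cmod (t j z))\<^sup>2)"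
proof -
  have "cmod (sesq y (block_pert t w B z) x) \<le> norm (conj_vec y) * norm (B *v weighted_vec t w z x)"
    unfolding sesq_def block_pert_mult_vec by (rule bilinear_norm_bound)
  also have "\<dots> \<le> 1 * norm (weighted_vec t w z x)"
    using assms spectral_norm_bound[of B "weighted_vec t w z x"] mult_right_mono[OF assms(1) norm_ge_zero]
    by (fastforce intro: order_trans)
  finally show ?thesis by (simp add: norm_weighted_vec assms)
qed

text \<open>
  Equality in the Cauchy-Schwarz inequality behind the preceding bound: with \<open>u\<close> the weighted vector, the
  matrix \<open>c y u\<^sup>* / \<parallel>u\<parallel>\<close> has norm at most \<open>1\<close> and maps \<open>u\<close> to \<open>c \<parallel>u\<parallel> y\<close>.  For \<open>u = 0\<close> it is the zero matrix, as
  division by zero yields zero, and the claim still holds.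
\<close>

lemma sesq_block_pert_attained:
  fixes x y :: "complex^'n" and t :: "'k::finite \<Rightarrow> complex \<Rightarrow> complex"
  assumes "norm x = 1" "norm y = 1" "cmod c = 1"
  obtains B :: "complex^('k \<times> 'n)^'n" where "spectral_norm B \<le> 1"
    "sesq y (block_pert t w B z) x = c * of_real (sqrt (\<Sum>j\<in>UNIV. (w j)\<^sup>2 * (cmod (t j z))\<^sup>2))"
proof -
  define u where "u = weighted_vec t w z x"
  define B :: "complex^('k \<times> 'n)^'n" where "B = (\<chi> p e. c * y $ p * conj_vec u $ e / of_real (norm u))"
  have Bv: "B *v v = (c * (\<Sum>e\<in>UNIV. conj_vec u $ e * v $ e) / of_real (norm u)) *s y" for v
    by (simp add: vec_eq_iff B_def matrix_vector_mult_def sum_distrib_left sum_distrib_right sum_divide_distrib mult_ac)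
  have "spectral_norm B \<le> 1"
  proof (rule spectral_norm_leI)
    fix v :: "complex^('k \<times> 'n)"
    have "norm (B *v v) = cmod (\<Sum>e\<in>UNIV. conj_vec u $ e * v $ e) / norm u"
      by (simp add: Bv norm_vec_scale assms norm_mult norm_divide)
    also have "\<dots> \<le> norm u * norm v / norm u"
      using bilinear_norm_bound[of "conj_vec u" v] by (intro divide_right_mono) simp_all
    also have "\<dots> \<le> 1 * norm v" by simp
    finally show "norm (B *v v) \<le> 1 * norm v" .
  qed
  moreover have "sesq y (block_pert t w B z) x = c * of_real (norm u)"
  proof -
    have "B *v u = (c * of_real (norm u)) *s y"
      unfolding Bv conj_vec_self by (simp add: power2_eq_square)
    hence "sesq y (block_pert t w B z) x = (\<Sum>i\<in>UNIV. c * of_real (norm u) * (conj_vec y $ i * y $ i))"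
      by (simp add: sesq_def block_pert_mult_vec u_def[symmetric] mult_ac)
    also have "\<dots> = c * of_real (norm u)"
      by (simp only: sum_distrib_left[symmetric] conj_vec_self assms) simp
    finally show ?thesis .
  qed
  ultimately show ?thesis
    using that[of B] by (simp add: u_def norm_weighted_vec assms)
qed

section \<open>The tracked eigenvalue as a holomorphic function\<close>

text \<open>
  The situation near one eigenvalue \<open>a\<close> of \<open>T\<close>: every perturbation of norm at most \<open>R\<close> leaves exactly one
  eigenvalue, a simple one, in the disc of radius \<open>r\<close> around \<open>a\<close>.
\<close>

locale eigval_tracking =
  fixes D :: "complex set" and t :: "'k::finite \<Rightarrow> complex \<Rightarrow> complex"
    and T :: "'k \<Rightarrow> complex^'n^'n" and w :: "'k \<Rightarrow> real" and a :: complex and r R :: real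
  assumes open_D: "open D" and hol_t: "\<And>j. t j holomorphic_on D"
    and r: "0 < r" and ball_sub: "ball a r \<subseteq> D" and R: "0 < R"
    and zero_a: "det (matfun t T a) = 0"
    and unique: "\<And>B :: complex^('k \<times> 'n)^'n. spectral_norm B \<le> R \<Longrightarrow>
      \<exists>z. {z \<in> ball a r. det (matfun t T z + block_pert t w B z) = 0} = {z} \<and>
        zorder (\<lambda>z. det (matfun t T z + block_pert t w B z)) z = 1"
begin

definition char_fun :: "complex^('k \<times> 'n)^'n \<Rightarrow> complex \<Rightarrow> complex" where
  "char_fun B z = det (matfun t T z + block_pert t w B z)"

definition tracked :: "complex^('k \<times> 'n)^'n \<Rightarrow> complex" where
  "tracked B = (THE z. z \<in> ball a r \<and> char_fun B z = 0)"

text \<open>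
  The complex parameter is essential: it makes the eigenvalue a holomorphic function on a disc.
\<close>

definition eig_path :: "complex^('k \<times> 'n)^'n \<Rightarrow> complex \<Rightarrow> complex" where
  "eig_path B v = tracked (cscale v B)"

lemma entry_hol: "(\<lambda>z. (matfun t T z + block_pert t w B z) $ i $ j) holomorphic_on D"
  unfolding vector_add_component matfun_nth block_pert_def vec_lambda_beta
  by (intro holomorphic_intros hol_t)

lemma block_pert_cont: "z \<in> D \<Longrightarrow> isCont (\<lambda>z. block_pert t w B z $ i $ j) z"
  unfolding block_pert_def vec_lambda_beta
  using hol_t open_D by (intro continuous_intros) (meson continuous_on_eq_continuous_at holomorphic_on_imp_continuous_on)

lemma char_fun_hol: "char_fun B holomorphic_on D"
  unfolding char_fun_def by (intro holomorphic_on_det entry_hol)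

text \<open>
  The order of the zero would say nothing about a function vanishing identically near that zero; uniqueness of the zero
  excludes this case.
\<close>

lemma
  assumes "spectral_norm B \<le> R"
  shows tracked_in: "tracked B \<in> ball a r"
    and tracked_iff: "z \<in> ball a r \<Longrightarrow> char_fun B z = 0 \<longleftrightarrow> z = tracked B"
    and tracked_simple: "deriv (char_fun B) (tracked B) \<noteq> 0"
proof -
  obtain z0 where z0: "{z \<in> ball a r. char_fun B z = 0} = {z0}" "zorder (char_fun B) z0 = 1"
    using unique[OF assms] unfolding char_fun_def[abs_def] by blast
  have "tracked B = z0"
    unfolding tracked_def by (rule the_equality) (use z0(1) in blast)+
  with z0 show *: "tracked B \<in> ball a r" "z \<in> ball a r \<Longrightarrow> char_fun B z = 0 \<longleftrightarrow> z = tracked B" for z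
    by blast+
  show "deriv (char_fun B) (tracked B) \<noteq> 0"
  proof (rule simple_zero_deriv)
    show "char_fun B holomorphic_on ball a r"
      using char_fun_hol ball_sub holomorphic_on_subset by blast
    have "ball a r \<noteq> {z0}"
      using not_open_singleton open_ball by metis
    thus "\<exists>z\<in>ball a r. char_fun B z \<noteq> 0"
      using z0(1) by blast
  qed (use * z0 \<open>tracked B = z0\<close> in auto)
qed

lemma tracked_0: "tracked 0 = a"
proof -
  have "spectral_norm (0 :: complex^('k \<times> 'n)^'n) \<le> 0"
    by (rule spectral_norm_leI) simp
  hence "char_fun 0 a = 0 \<longleftrightarrow> a = tracked 0"
    using R r by (intro tracked_iff) auto
  moreover have "block_pert t w (0 :: complex^('k \<times> 'n)^'n) a = 0"
    by (simp add: block_pert_def vec_eq_iff)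
  ultimately show ?thesis using zero_a by (simp add: char_fun_def)
qed

lemma tracked_cont: "continuous_on {B. spectral_norm B \<le> R} tracked"
proof (rule unique_zero_continuous[where F = char_fun])
  have t: "continuous_on (X \<times> ball a r) (\<lambda>p. t l (snd p))" for l and X :: "(complex^('k \<times> 'n)^'n) set"
    by (rule continuous_on_compose2[OF holomorphic_on_imp_continuous_on[OF hol_t]])
       (use ball_sub in \<open>auto intro!: continuous_intros\<close>)
  show "continuous_on ({B. spectral_norm B \<le> R} \<times> ball a r) (\<lambda>(B, z). char_fun B z)"
    unfolding char_fun_def case_prod_beta
    by (rule continuous_on_det, unfold vector_add_component matfun_nth block_pert_def vec_lambda_beta)
       (intro continuous_intros t)
qed (use char_fun_hol ball_sub holomorphic_on_subset tracked_in tracked_iff in blast)+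

lemma cscale_le:
  assumes "spectral_norm B \<le> 1" "cmod v \<le> R"
  shows "spectral_norm (cscale v B) \<le> R"
proof -
  have "cmod v * spectral_norm B \<le> R * 1"
    using assms R by (intro mult_mono spectral_norm_nonneg) auto
  thus ?thesis using spectral_norm_cscale[of v B] by simp
qed

lemma eig_path_0: "eig_path B 0 = a"
proof -
  have "cscale 0 B = 0" by (simp add: vec_eq_iff)
  thus ?thesis by (simp add: eig_path_def tracked_0)
qed

lemma eig_path_cont:
  assumes "spectral_norm B \<le> 1"
  shows "continuous_on (cball 0 R) (eig_path B)"
  unfolding eig_path_def
proof (rule continuous_on_compose2[OF tracked_cont])
  show "continuous_on (cball 0 R) (\<lambda>v. cscale v B)"
  proof -
    have "(\<lambda>v. cscale v B) = (\<lambda>v. \<chi> i j. v * B $ i $ j)"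
      by (simp add: vec_eq_iff fun_eq_iff)
    thus ?thesis by (simp only:) (intro continuous_intros)
  qed
qed (use cscale_le[OF assms] in auto)

text \<open>
  Around \<open>v0\<close> the perturbed matrix is \<open>N z + (v - v0) * block_pert t w B z\<close>, to which \<open>implicit_deriv\<close> applies;
  the denominator is nonzero because the eigenvalue at \<open>v0\<close> is simple.
\<close>

lemma eig_path_deriv_at:
  assumes B: "spectral_norm B \<le> 1" and v0: "cmod v0 < R"
    and N: "N = (\<lambda>z. matfun t T z + block_pert t w (cscale v0 B) z)"
    and z0: "z0 = eig_path B v0"
    and q: "q v* N z0 = 0" "q $ k \<noteq> 0"
  shows "det_row k (N z0) (q v* mat_deriv N z0) \<noteq> 0"
    and "(eig_path B has_field_derivative
      - det_row k (N z0) (q v* block_pert t w B z0) / det_row k (N z0) (q v* mat_deriv N z0)) (at v0)"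
proof -
  let ?b = "det_row k (N z0) (q v* mat_deriv N z0)"
  have sn: "spectral_norm (cscale v0 B) \<le> R"
    using cscale_le[OF B] v0 by simp
  have N_hol: "(\<lambda>z. N z $ i $ j) holomorphic_on D" for i j
    unfolding N by (rule entry_hol)
  have z0D: "z0 \<in> D"
    using tracked_in[OF sn] ball_sub by (auto simp: z0 eig_path_def)
  have "(\<lambda>z. det (N z)) = char_fun (cscale v0 B)"
    by (simp add: N char_fun_def fun_eq_iff)
  with det_row_deriv[OF open_D z0D N_hol q] show b: "?b \<noteq> 0"
    using tracked_simple[OF sn] q(2) by (simp add: z0 eig_path_def)
  have isCont: "isCont (eig_path B) v0"
    using eig_path_cont[OF B] v0 by (intro continuous_on_interior[of "cball 0 R"]) auto
  have "\<forall>\<^sub>F v in at v0. v \<in> ball 0 R"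
    using v0 by (intro eventually_at_in_open') auto
  hence zero: "\<forall>\<^sub>F v in at v0. det (N (eig_path B v) + cscale (v - v0) (block_pert t w B (eig_path B v))) = 0"
  proof eventually_elim
    case (elim v)
    have "N z + cscale (v - v0) (block_pert t w B z) = matfun t T z + block_pert t w (cscale v B) z" for z
      unfolding N block_pert_cscale vec_eq_iff vector_add_component nth_map_matrix
      by (simp add: algebra_simps)
    hence "det (N z + cscale (v - v0) (block_pert t w B z)) = char_fun (cscale v B) z" for z
      by (simp only: char_fun_def)
    moreover have "spectral_norm (cscale v B) \<le> R"
      using cscale_le[OF B] elim by simp
    ultimately show ?case
      using tracked_iff tracked_in by (simp add: eig_path_def)
  qed
  show "(eig_path B has_field_derivative - det_row k (N z0) (q v* block_pert t w B z0) / ?b) (at v0)"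
    by (rule implicit_deriv[OF open_D z0D N_hol block_pert_cont[OF z0D] q(1) isCont z0[symmetric] zero b])
qed

lemma eig_path_hol:
  assumes B: "spectral_norm B \<le> 1"
  shows "eig_path B holomorphic_on ball 0 R"
proof (subst holomorphic_on_open, simp, intro ballI)
  fix v :: complex assume v: "v \<in> ball 0 R"
  hence sn: "spectral_norm (cscale v B) \<le> R"
    using cscale_le[OF B] by simp
  define N where "N = (\<lambda>z. matfun t T z + block_pert t w (cscale v B) z)"
  have "det (N (eig_path B v)) = 0"
    using tracked_iff[OF sn tracked_in[OF sn]] by (simp add: N_def char_fun_def eig_path_def)
  then obtain q k where "q v* N (eig_path B v) = 0" "q $ k \<noteq> 0"
    by (rule ex_left_kernel)
  from eig_path_deriv_at(2)[OF B _ N_def refl this] v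
  show "\<exists>f'. (eig_path B has_field_derivative f') (at v)" by auto
qed

text \<open>
  At \<open>v = 0\<close> the left kernel vector can be taken from \<open>y\<close>, and \<open>det_row_cross\<close> turns the quotient of
  determinants into the quotient of pairings with \<open>x\<close>.  Evaluating the same relation at a unit
  vector \<open>axis j 1\<close> with \<open>x $ j \<noteq> 0\<close> shows that the denominator does not vanish.
\<close>

lemma eig_path_deriv_0:
  assumes B: "spectral_norm B \<le> 1"
    and x: "unit_right_eigvec (matfun t T) a x" and y: "unit_left_eigvec (matfun t T) a y"
  shows "sesq y (mat_deriv (matfun t T) a) x \<noteq> 0"
    and "deriv (eig_path B) 0 = - sesq y (block_pert t w B a) x / sesq y (mat_deriv (matfun t T) a) x"
proof -
  let ?q = "conj_vec y"
  have "norm y = 1" using y by (simp add: unit_left_eigvec_def)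
  then obtain k where k: "?q $ k \<noteq> 0"
    by (metis conj_vec_def complex_cnj_zero_iff norm_zero vec_eq_iff vec_lambda_beta zero_index zero_neq_one)
  have q: "?q v* matfun t T a = 0" and x0: "matfun t T a *v x = 0" "x \<noteq> 0"
    using x y by (auto simp: unit_right_eigvec_def unit_left_eigvec_def)
  define A where "A = matfun t T a"
  define b where "b = det_row k A (?q v* mat_deriv (matfun t T) a)"
  have N: "matfun t T = (\<lambda>z. matfun t T z + block_pert t w (cscale 0 B) z)"
    by (simp add: fun_eq_iff vec_eq_iff block_pert_def)
  have b: "b \<noteq> 0" and der: "(eig_path B has_field_derivative - det_row k A (?q v* block_pert t w B a) / b) (at 0)"
    using eig_path_deriv_at[OF B _ N eig_path_0[symmetric] q k] R unfolding A_def b_def by auto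
  have sesq: "sesq y M x = (\<Sum>j\<in>UNIV. (?q v* M) $ j * x $ j)" for M
    unfolding sesq_def matrix_vector_mult_def vector_matrix_mult_def vec_lambda_beta
      sum_distrib_left sum_distrib_right
    by (subst sum.swap) (simp add: mult_ac)
  have cross: "b * (\<Sum>j\<in>UNIV. u $ j * x $ j) = det_row k A u * sesq y (mat_deriv (matfun t T) a) x" for u
    unfolding b_def sesq using x0 by (intro det_row_cross) (simp_all add: A_def)
  obtain j where j: "x $ j \<noteq> 0"
    using x0(2) by (auto simp: vec_eq_iff)
  have "(\<Sum>i\<in>UNIV. axis j 1 $ i * x $ i) = x $ j"
    by (simp add: axis_def mult_delta_left)
  with cross[of "axis j 1"] j b show nz: "sesq y (mat_deriv (matfun t T) a) x \<noteq> 0" by auto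
  have "b * sesq y (block_pert t w B a) x = det_row k A (?q v* block_pert t w B a) * sesq y (mat_deriv (matfun t T) a) x"
    unfolding sesq[of "block_pert t w B a"] by (rule cross)
  hence "- det_row k A (?q v* block_pert t w B a) / b = - sesq y (block_pert t w B a) x / sesq y (mat_deriv (matfun t T) a) x"
    using nz b by (simp add: field_simps)
  thus "deriv (eig_path B) 0 = - sesq y (block_pert t w B a) x / sesq y (mat_deriv (matfun t T) a) x"
    using DERIV_imp_deriv[OF der] by simp
qed

text \<open>
  The first order rate at which the rightmost position of the tracked eigenvalue moves as the
  perturbation norm grows.
\<close>

definition speed :: "complex^'n \<Rightarrow> complex^'n \<Rightarrow> real" where
  "speed x y = sqrt (\<Sum>j\<in>UNIV. (w j)\<^sup>2 * (cmod (t j a))\<^sup>2) / cmod (sesq y (mat_deriv (matfun t T) a) x)"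

lemma speed_nonneg: "0 \<le> speed x y"
  by (simp add: speed_def sum_nonneg)

lemma deriv_le_speed:
  assumes "spectral_norm B \<le> 1"
    and x: "unit_right_eigvec (matfun t T) a x" and y: "unit_left_eigvec (matfun t T) a y"
  shows "cmod (deriv (eig_path B) 0) \<le> speed x y"
  using sesq_block_pert_bound[OF assms(1), of x y t w a] x y
  by (simp add: eig_path_deriv_0(2)[OF assms] speed_def norm_divide divide_right_mono
      unit_right_eigvec_def unit_left_eigvec_def)

text \<open>
  The unimodular factor left open by \<open>sesq_block_pert_attained\<close> is used to make the derivative a
  positive multiple of \<open>1\<close>.
\<close>

lemma speed_attained:
  assumes x: "unit_right_eigvec (matfun t T) a x" and y: "unit_left_eigvec (matfun t T) a y"
  obtains B where "spectral_norm B \<le> 1" "deriv (eig_path B) 0 = of_real (speed x y)"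
proof -
  define d where "d = sesq y (mat_deriv (matfun t T) a) x"
  have "spectral_norm (0 :: complex^('k \<times> 'n)^'n) \<le> 1"
    by (rule spectral_norm_leI) simp
  hence d: "d \<noteq> 0"
    unfolding d_def by (rule eig_path_deriv_0(1)[OF _ x y])
  have "cmod (- (d / cmod d)) = 1" using d by (simp add: norm_divide)
  with x y obtain B :: "complex^('k \<times> 'n)^'n" where B: "spectral_norm B \<le> 1" "sesq y (block_pert t w B a) x
      = - (d / cmod d) * of_real (sqrt (\<Sum>j\<in>UNIV. (w j)\<^sup>2 * (cmod (t j a))\<^sup>2))"
    using sesq_block_pert_attained[of x y "- (d / cmod d)" t w a]
    unfolding unit_right_eigvec_def unit_left_eigvec_def by blast
  have "deriv (eig_path B) 0 = of_real (speed x y)"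
    using d by (simp add: eig_path_deriv_0(2)[OF B(1) x y] B(2) speed_def d_def[symmetric])
  with B(1) show ?thesis by (rule that)
qed

lemma rightmost_attained:
  assumes "0 \<le> \<epsilon>" "\<epsilon> \<le> R"
  obtains B where "spectral_norm B \<le> \<epsilon>" "\<And>C. spectral_norm C \<le> \<epsilon> \<Longrightarrow> Re (tracked C) \<le> Re (tracked B)"
proof -
  let ?S = "{B :: complex^('k \<times> 'n)^'n. spectral_norm B \<le> \<epsilon>}"
  have cont: "continuous_on ?S (\<lambda>B. Re (tracked B))"
    using assms by (intro continuous_intros continuous_on_subset[OF tracked_cont]) auto
  have "spectral_norm (0 :: complex^('k \<times> 'n)^'n) \<le> 0"
    by (rule spectral_norm_leI) simp
  hence "0 \<in> ?S" using assms(1) by simp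
  hence "?S \<noteq> {}" by blast
  from continuous_attains_sup[OF compact_spectral_ball this cont]
  show ?thesis using that by auto
qed

context
  fixes M :: real
  assumes M: "\<And>B. spectral_norm B \<le> R \<Longrightarrow> Re (tracked B) < M"
begin

lemma eig_path_expansion:
  assumes B: "spectral_norm B \<le> 1" and \<epsilon>: "0 \<le> \<epsilon>" "\<epsilon> \<le> R / 4"
  shows "\<bar>Re (eig_path B \<epsilon>) - (Re a + \<epsilon> * Re (deriv (eig_path B) 0))\<bar> \<le> 96 * (M - Re a) / R\<^sup>2 * \<epsilon>\<^sup>2"
proof -
  have "Re (eig_path B v) < M" if "v \<in> ball 0 R" for v
    unfolding eig_path_def using that by (intro M cscale_le[OF B]) simp
  from Re_bound_imp_deriv_bound(2)[OF eig_path_hol[OF B] R this, of "of_real \<epsilon>"] \<epsilon>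
  have "cmod (eig_path B \<epsilon> - a - deriv (eig_path B) 0 * \<epsilon>) \<le> 96 * (M - Re a) / R\<^sup>2 * \<epsilon>\<^sup>2"
    by (simp add: eig_path_0)
  moreover have "\<bar>Re (eig_path B \<epsilon> - a - deriv (eig_path B) 0 * \<epsilon>)\<bar> \<le> cmod (eig_path B \<epsilon> - a - deriv (eig_path B) 0 * \<epsilon>)"
    by (rule abs_Re_le_cmod)
  ultimately show ?thesis
    by (simp add: algebra_simps)
qed

lemma speed_bound:
  assumes x: "unit_right_eigvec (matfun t T) a x" and y: "unit_left_eigvec (matfun t T) a y"
  shows "speed x y \<le> 6 * (M - Re a) / R"
proof -
  obtain B where B: "spectral_norm B \<le> 1" "deriv (eig_path B) 0 = of_real (speed x y)"
    using speed_attained[OF x y] .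
  have "Re (eig_path B v) < M" if "v \<in> ball 0 R" for v
    unfolding eig_path_def using that by (intro M cscale_le[OF B(1)]) simp
  from Re_bound_imp_deriv_bound(1)[OF eig_path_hol[OF B(1)] R this]
  show ?thesis using speed_nonneg[of x y] by (simp add: B(2) eig_path_0)
qed

text \<open>
  The expansion along each path is applied twice: to the path through the rightmost position, whose derivative
  is at most the speed, and to the path of a perturbation whose derivative is equal to the speed.
\<close>

lemma rightmost_expansion:
  assumes x: "unit_right_eigvec (matfun t T) a x" and y: "unit_left_eigvec (matfun t T) a y"
    and \<epsilon>: "0 < \<epsilon>" "\<epsilon> \<le> R / 4"
    and B: "spectral_norm B \<le> \<epsilon>" "\<And>C. spectral_norm C \<le> \<epsilon> \<Longrightarrow> Re (tracked C) \<le> Re (tracked B)"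
  shows "\<bar>Re (tracked B) - (Re a + \<epsilon> * speed x y)\<bar> \<le> 96 * (M - Re a) / R\<^sup>2 * \<epsilon>\<^sup>2"
proof -
  have "B \<in> cscale (of_real \<epsilon>) ` {B. spectral_norm B \<le> 1}"
    using B(1) unfolding spectral_ball_eq_scaled[OF \<epsilon>(1), symmetric] by simp
  then obtain B' where B': "spectral_norm B' \<le> 1" and "B = cscale (of_real \<epsilon>) B'" by blast
  hence tracked_B: "tracked B = eig_path B' \<epsilon>"
    by (simp only: eig_path_def)
  have "Re (deriv (eig_path B') 0) \<le> speed x y"
    using deriv_le_speed[OF B' x y] complex_Re_le_cmod[of "deriv (eig_path B') 0"] by linarith
  hence "\<epsilon> * Re (deriv (eig_path B') 0) \<le> \<epsilon> * speed x y"
    using \<epsilon>(1) by simp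
  hence upper: "Re (tracked B) \<le> Re a + \<epsilon> * speed x y + 96 * (M - Re a) / R\<^sup>2 * \<epsilon>\<^sup>2"
    using eig_path_expansion[OF B', of \<epsilon>] \<epsilon> unfolding tracked_B by linarith
  obtain C where C: "spectral_norm C \<le> 1" "deriv (eig_path C) 0 = of_real (speed x y)"
    using speed_attained[OF x y] .
  have "cscale (of_real \<epsilon>) C \<in> {B. spectral_norm B \<le> \<epsilon>}"
    unfolding spectral_ball_eq_scaled[OF \<epsilon>(1)] using C(1) by blast
  hence "spectral_norm (cscale (of_real \<epsilon>) C) \<le> \<epsilon>" by simp
  hence "Re (eig_path C \<epsilon>) \<le> Re (tracked B)"
    unfolding eig_path_def by (rule B(2))
  hence "Re (tracked B) \<ge> Re a + \<epsilon> * speed x y - 96 * (M - Re a) / R\<^sup>2 * \<epsilon>\<^sup>2"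
    using eig_path_expansion[OF C(1), of \<epsilon>] \<epsilon> C(2) by auto
  with upper show ?thesis by (simp add: abs_le_iff)
qed

end

text \<open>
  The set where \<open>\<gamma>\<close> agrees with the tracked eigenvalue is closed by continuity.  By uniqueness it is also the
  set where \<open>\<gamma>\<close> lies in the open disc, hence open, and it contains \<open>0\<close>.
\<close>

lemma continued_path:
  assumes B: "spectral_norm B \<le> 1" and \<epsilon>: "0 \<le> \<epsilon>" "\<epsilon> \<le> R"
    and \<gamma>: "continuous_on {0..\<epsilon>} \<gamma>" "\<And>\<eta>. \<eta> \<in> {0..\<epsilon>} \<Longrightarrow> char_fun (cscale (of_real \<eta>) B) (\<gamma> \<eta>) = 0"
    and start: "\<gamma> 0 = a"
  shows "\<gamma> \<epsilon> = eig_path B (of_real \<epsilon>)"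
proof -
  let ?p = "\<lambda>\<eta>. eig_path B (of_real \<eta>)"
  let ?I = "{0..\<epsilon>}"
  have p: "continuous_on ?I ?p"
    by (rule continuous_on_compose2[OF eig_path_cont[OF B]]) (use \<epsilon> in \<open>auto intro!: continuous_intros\<close>)
  have iff: "\<gamma> \<eta> = ?p \<eta> \<longleftrightarrow> \<gamma> \<eta> \<in> ball a r" if "\<eta> \<in> ?I" for \<eta>
  proof -
    have "spectral_norm (cscale (of_real \<eta>) B) \<le> R"
      using that \<epsilon> by (intro cscale_le[OF B]) auto
    from tracked_iff[OF this, of "\<gamma> \<eta>"] tracked_in[OF this] \<gamma>(2)[OF that] show ?thesis
      unfolding eig_path_def by auto
  qed
  define S where "S = {\<eta> \<in> ?I. \<gamma> \<eta> = ?p \<eta>}"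
  have closed: "closedin (top_of_set ?I) S"
    using continuous_closedin_preimage_constant[OF continuous_on_diff[OF \<gamma>(1) p], of 0]
    unfolding S_def right_minus_eq .
  have "S = ?I \<inter> \<gamma> -` ball a r"
    unfolding S_def by (intro set_eqI) (simp only: mem_Collect_eq Int_iff vimage_eq iff cong: conj_cong)
  hence "openin (top_of_set ?I) S"
    using continuous_openin_preimage_gen[OF \<gamma>(1) open_ball] by (simp only:)
  with closed connected_Icc[of 0 \<epsilon>] have "S = {} \<or> S = ?I"
    unfolding connected_clopen by meson
  moreover have "0 \<in> S"
    using \<epsilon> start by (simp add: S_def eig_path_0)
  ultimately have "S = ?I" by blast
  hence "\<epsilon> \<in> S"
    using \<epsilon> by simp
  thus ?thesis
    unfolding S_def by blast
qed

end

section \<open>Tracked abscissas\<close>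

lemma max_of_eqI: "m \<in> A \<Longrightarrow> (\<And>x. x \<in> A \<Longrightarrow> x \<le> m) \<Longrightarrow> max_of A = m"
  unfolding max_of_def by (rule Greatest_equality)

lemma
  assumes "sup_attained A"
  shows max_of_in: "max_of A \<in> A" and max_of_ge: "x \<in> A \<Longrightarrow> x \<le> max_of A"
proof -
  obtain m where m: "m \<in> A" "\<forall>x\<in>A. x \<le> m"
    using assms by (auto simp: sup_attained_def)
  hence "max_of A = m" by (intro max_of_eqI) auto
  with m show "max_of A \<in> A" "x \<in> A \<Longrightarrow> x \<le> max_of A" by auto
qed

lemma scaled_pert_eq_block_pert:
  "(\<eta> :: real) *\<^sub>R pert t w \<Delta> z = block_pert t w (cscale (of_real \<eta>) (block_row \<Delta>)) z"
  unfolding pert_eq_block_pert block_pert_cscale vec_eq_iff vector_scaleR_component nth_map_matrix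
  by (simp add: scaleR_conv_of_real)

text \<open>
  Every block row of norm at most \<open>R\<close> is \<open>R\<close> times an element of the unit ball, so a single parameter \<open>R\<close> of
  the interval controls all perturbations of norm at most \<open>R\<close>.
\<close>

lemma eigval_trackingI:
  fixes t :: "'k::finite \<Rightarrow> complex \<Rightarrow> complex" and T :: "'k \<Rightarrow> complex^'n^'n"
  assumes "open D" "\<And>j. t j holomorphic_on D"
    and \<mu>0: "\<mu>0 \<in> eigvals D (matfun t T)" and nbhd: "tracking_nbhd D t T w \<mu>0 U r"
    and R: "0 < R" "R \<in> U"
  shows "eigval_tracking D t T w \<mu>0 r R"
proof
  show "open D" "t j holomorphic_on D" for j
    using assms by blast+
  show r: "0 < r" and sub: "ball \<mu>0 r \<subseteq> D"
    using nbhd by (auto simp: tracking_nbhd_def)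
  show "det (matfun t T \<mu>0) = 0" using \<mu>0 by (simp add: eigvals_def)
  show "0 < R" by (rule R)
  fix B :: "complex^('k \<times> 'n)^'n" assume B: "spectral_norm B \<le> R"
  hence "B \<in> cscale (of_real R) ` block_row ` pert_set 1"
    unfolding block_row_image_pert_set spectral_ball_eq_scaled[OF R(1), symmetric] by simp
  then obtain \<Delta> :: "'k \<Rightarrow> complex^'n^'n"
    where \<Delta>: "\<Delta> \<in> pert_set 1" and B_eq: "B = cscale (of_real R) (block_row \<Delta>)" by blast
  have eq: "R *\<^sub>R pert t w \<Delta> z = block_pert t w B z" for z
    unfolding scaled_pert_eq_block_pert B_eq ..
  obtain z where z: "pert_eigvals D t T w \<Delta> R \<inter> ball \<mu>0 r = {z}"
      "simple_eigval D (\<lambda>z. matfun t T z + R *\<^sub>R pert t w \<Delta> z) z"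
    using nbhd \<Delta> R(2) unfolding tracking_nbhd_def by blast
  show "\<exists>z. {z \<in> ball \<mu>0 r. det (matfun t T z + block_pert t w B z) = 0} = {z} \<and>
      zorder (\<lambda>z. det (matfun t T z + block_pert t w B z)) z = 1"
    using z sub unfolding eq eigvals_def simple_eigval_def by blast
qed

context eigval_tracking
begin

lemma tracked_in_D: "spectral_norm B \<le> R \<Longrightarrow> tracked B \<in> D"
  using tracked_in ball_sub by blast

lemma tracked_root: "spectral_norm B \<le> R \<Longrightarrow> det (matfun t T (tracked B) + block_pert t w B (tracked B)) = 0"
  using tracked_iff tracked_in unfolding char_fun_def by blast

lemma tracked_eigval_eq_tracked:
  "tracked_eigval D t T w r \<eta> \<Delta> a = tracked (cscale (of_real \<eta>) (block_row \<Delta>))"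
  unfolding tracked_eigval_def tracked_def eigvals_def scaled_pert_eq_block_pert char_fun_def
  by (rule arg_cong[where f = The], rule ext) (use ball_sub in blast)

text \<open>
  The maximum over the unit ball scaled by \<open>\<epsilon>\<close> is attained by compactness, so \<open>max_of\<close> has its
  intended meaning here.
\<close>

lemma tracked_le_tracked_abscissa:
  assumes "0 < \<epsilon>" "\<epsilon> \<le> R"
  shows "spectral_norm C \<le> \<epsilon> \<Longrightarrow> Re (tracked C) \<le> tracked_abscissa D t T w r \<epsilon> a"
    and "\<exists>B. spectral_norm B \<le> \<epsilon> \<and> tracked_abscissa D t T w r \<epsilon> a = Re (tracked B)"
proof -
  let ?S = "{B :: complex^('k \<times> 'n)^'n. spectral_norm B \<le> \<epsilon>}"
  have eq: "(\<lambda>\<Delta>. Re (tracked_eigval D t T w r \<epsilon> \<Delta> a)) ` pert_set 1 = (\<lambda>B. Re (tracked B)) ` ?S"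
    unfolding tracked_eigval_eq_tracked spectral_ball_eq_scaled[OF assms(1)] block_row_image_pert_set[symmetric] image_image ..
  obtain B where B: "spectral_norm B \<le> \<epsilon>" "\<And>C. spectral_norm C \<le> \<epsilon> \<Longrightarrow> Re (tracked C) \<le> Re (tracked B)"
    using rightmost_attained[of \<epsilon>] assms by auto
  have *: "tracked_abscissa D t T w r \<epsilon> a = Re (tracked B)"
    unfolding tracked_abscissa_def eq by (rule max_of_eqI) (use B in auto)
  show "\<exists>B. spectral_norm B \<le> \<epsilon> \<and> tracked_abscissa D t T w r \<epsilon> a = Re (tracked B)"
    using B(1) * by blast
  show "spectral_norm C \<le> \<epsilon> \<Longrightarrow> Re (tracked C) \<le> tracked_abscissa D t T w r \<epsilon> a"
    using B(2) * by simp
qed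

lemma Re_le_tracked_abscissa:
  assumes "0 < \<epsilon>" "\<epsilon> \<le> R"
  shows "Re a \<le> tracked_abscissa D t T w r \<epsilon> a"
proof -
  have "spectral_norm (0 :: complex^('k \<times> 'n)^'n) \<le> 0"
    by (rule spectral_norm_leI) simp
  hence "Re (tracked 0) \<le> tracked_abscissa D t T w r \<epsilon> a"
    using assms by (intro tracked_le_tracked_abscissa) auto
  thus ?thesis by (simp add: tracked_0)
qed

lemma tracked_abscissa_expansion:
  assumes M: "tracked_abscissa D t T w r R a < M"
    and x: "unit_right_eigvec (matfun t T) a x" and y: "unit_left_eigvec (matfun t T) a y"
    and \<epsilon>: "0 < \<epsilon>" "\<epsilon> \<le> R / 4"
  shows "\<bar>tracked_abscissa D t T w r \<epsilon> a - (Re a + \<epsilon> * speed x y)\<bar> \<le> 96 * (M - Re a) / R\<^sup>2 * \<epsilon>\<^sup>2"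
    and "speed x y \<le> 6 * (M - Re a) / R"
proof -
  have M': "Re (tracked B) < M" if "spectral_norm B \<le> R" for B
    using tracked_le_tracked_abscissa(1)[of R B] that M R by simp
  have \<epsilon>R: "\<epsilon> \<le> R" using \<epsilon> by simp
  obtain B where B: "spectral_norm B \<le> \<epsilon>" "tracked_abscissa D t T w r \<epsilon> a = Re (tracked B)"
    using tracked_le_tracked_abscissa(2)[OF \<epsilon>(1) \<epsilon>R] by blast
  show "\<bar>tracked_abscissa D t T w r \<epsilon> a - (Re a + \<epsilon> * speed x y)\<bar> \<le> 96 * (M - Re a) / R\<^sup>2 * \<epsilon>\<^sup>2"
    unfolding B(2) using tracked_le_tracked_abscissa(1)[OF \<epsilon>(1) \<epsilon>R]
    by (intro rightmost_expansion[OF M' x y \<epsilon> B(1)]) (simp_all add: B(2))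
  show "speed x y \<le> 6 * (M - Re a) / R"
    by (rule speed_bound[OF M' x y])
qed

end

section \<open>Comparing the two maxima\<close>

text \<open>
  Here \<open>\<rho> i\<close> is the real part of the unperturbed eigenvalue, \<open>a i\<close> its abscissa and \<open>b i\<close> the first order
  approximation.  Since \<open>a i\<close> and \<open>b i\<close> are at most \<open>\<rho> i + (M - \<rho> i) / 2\<close>, an index for which one of them is
  at least \<open>\<rho> s\<close> satisfies \<open>M - \<rho> i \<le> 2 * (M - \<rho> s)\<close>.  Only such indices matter for the maximum of \<open>a\<close> and the
  supremum of \<open>b\<close>, and for them the error is bounded independently of \<open>i\<close>.
\<close>

lemma Sup_close_to_max:
  fixes a b \<rho> :: "'i \<Rightarrow> real"
  assumes max: "i0 \<in> I" "\<And>i. i \<in> I \<Longrightarrow> a i \<le> a i0" and s: "s \<in> I"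
    and ge: "\<And>i. i \<in> I \<Longrightarrow> \<rho> i \<le> a i" "\<And>i. i \<in> I \<Longrightarrow> \<rho> i \<le> b i" "\<And>i. i \<in> I \<Longrightarrow> \<rho> i \<le> M"
    and close: "\<And>i. i \<in> I \<Longrightarrow> \<bar>a i - b i\<bar> \<le> e * (M - \<rho> i)"
    and growth: "\<And>i. i \<in> I \<Longrightarrow> b i \<le> \<rho> i + (M - \<rho> i) / 4"
    and e: "0 \<le> e" "e \<le> 1/4"
  shows "bdd_above (b ` I)" and "\<bar>a i0 - Sup (b ` I)\<bar> \<le> 2 * e * (M - \<rho> s)"
proof -
  have "b i \<le> M" if "i \<in> I" for i
    using growth[OF that] ge(3)[OF that] by (simp add: field_simps)
  thus bdd: "bdd_above (b ` I)" by (auto intro!: bdd_aboveI2)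
  have e4: "e * (M - \<rho> i) \<le> 1/4 * (M - \<rho> i)" if "i \<in> I" for i
    using e ge(3)[OF that] by (intro mult_right_mono) auto
  have competing: "e * (M - \<rho> i) \<le> 2 * e * (M - \<rho> s)"
    if "i \<in> I" "\<rho> s \<le> \<rho> i + (M - \<rho> i) / 2" for i
  proof -
    have "M - \<rho> i \<le> 2 * (M - \<rho> s)"
      using that(2) by (simp add: field_simps)
    hence "e * (M - \<rho> i) \<le> e * (2 * (M - \<rho> s))"
      using e(1) by (rule mult_left_mono)
    thus ?thesis by (simp only: mult.assoc mult.left_commute)
  qed
  have 0: "0 \<le> 2 * e * (M - \<rho> s)"
    using e ge(3)[OF s] by simp
  have "a i0 \<le> \<rho> i0 + (M - \<rho> i0) / 2"
    using close[OF max(1)] growth[OF max(1)] e4[OF max(1)] by linarith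
  hence "e * (M - \<rho> i0) \<le> 2 * e * (M - \<rho> s)"
    using max(2)[OF s] ge(1)[OF s] by (intro competing max(1)) simp
  moreover have "b i0 \<le> Sup (b ` I)"
    by (intro cSup_upper bdd imageI max(1))
  ultimately have "a i0 \<le> Sup (b ` I) + 2 * e * (M - \<rho> s)"
    using close[OF max(1)] by linarith
  moreover have "Sup (b ` I) \<le> a i0 + 2 * e * (M - \<rho> s)"
  proof (rule cSup_least)
    fix v assume "v \<in> b ` I"
    then obtain i where i: "i \<in> I" "v = b i" by blast
    show "v \<le> a i0 + 2 * e * (M - \<rho> s)"
    proof (cases "b i \<le> \<rho> s")
      case True
      thus ?thesis using i ge(1)[OF s] max(2)[OF s] 0 by linarith
    next
      case False
      hence "e * (M - \<rho> i) \<le> 2 * e * (M - \<rho> s)"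
        using growth[OF i(1)] ge(3)[OF i(1)] by (intro competing i(1)) (simp add: field_simps)
      thus ?thesis using close[OF i(1)] max(2)[OF i(1)] i by linarith
    qed
  qed (use s in blast)
  ultimately show "\<bar>a i0 - Sup (b ` I)\<bar> \<le> 2 * e * (M - \<rho> s)" by (simp add: abs_le_iff)
qed

theorem theorem2p3:
  fixes D :: "complex set"
    and t :: "'k::finite \<Rightarrow> complex \<Rightarrow> complex"
    and T :: "'k \<Rightarrow> complex^'n^'n"
    and w :: "'k \<Rightarrow> real"
    and U :: "complex \<Rightarrow> real set"
    and r :: "complex \<Rightarrow> real"
    and x y :: "complex \<Rightarrow> complex^'n"
  assumes "open D"
    and "\<And>j. t j holomorphic_on D"
    and regular: "\<exists>z\<in>D. det (matfun t T z) \<noteq> 0"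
    and "\<And>j. 0 \<le> w j"
    and "\<And>z. z \<in> D \<Longrightarrow> (\<Sum>j\<in>UNIV. w j * cmod (t j z)) \<noteq> 0"
    and simple: "\<And>\<mu>0. \<mu>0 \<in> eigvals D (matfun t T) \<Longrightarrow> simple_eigval D (matfun t T) \<mu>0"
    and isolated: "\<And>\<mu>0. \<mu>0 \<in> eigvals D (matfun t T) \<Longrightarrow> \<mu>0 isolated_in eigvals D (matfun t T)"
    and nbhd: "\<And>\<mu>0. \<mu>0 \<in> eigvals D (matfun t T) \<Longrightarrow> tracking_nbhd D t T w \<mu>0 (U \<mu>0) (r \<mu>0)"
    and right: "\<And>\<mu>0. \<mu>0 \<in> eigvals D (matfun t T) \<Longrightarrow> unit_right_eigvec (matfun t T) \<mu>0 (x \<mu>0)"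
    and left: "\<And>\<mu>0. \<mu>0 \<in> eigvals D (matfun t T) \<Longrightarrow> unit_left_eigvec (matfun t T) \<mu>0 (y \<mu>0)"
  shows "(\<forall>\<epsilon>. admissible D t T w U r \<epsilon> \<and> rightmost_continued D t T w \<epsilon> \<longrightarrow>
            pseudospectral_abscissa D t T w \<epsilon> = max_of (tracked_abscissas D t T w r \<epsilon>)) \<and>
         (\<forall>\<^sub>F \<epsilon> in at 0 within {\<epsilon>. admissible D t T w U r \<epsilon>}.
            bdd_above (first_order_abscissas D t T w x y \<epsilon>)) \<and>
         (\<lambda>\<epsilon>. max_of (tracked_abscissas D t T w r \<epsilon>) - Sup (first_order_abscissas D t T w x y \<epsilon>))
            \<in> O[at 0 within {\<epsilon>. admissible D t T w U r \<epsilon>}](\<lambda>\<epsilon>. \<epsilon>\<^sup>2) \<and>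
         (\<lambda>\<epsilon>. pseudospectral_abscissa D t T w \<epsilon> - Sup (first_order_abscissas D t T w x y \<epsilon>))
            \<in> O[at 0 within {\<epsilon>. admissible D t T w U r \<epsilon> \<and> rightmost_continued D t T w \<epsilon>}](\<lambda>\<epsilon>. \<epsilon>\<^sup>2)"
proof -
  define \<Lambda> where "\<Lambda> = eigvals D (matfun t T)"
  define adm where "adm \<epsilon> \<longleftrightarrow> admissible D t T w U r \<epsilon>" for \<epsilon>
  define R where "R \<epsilon> \<mu> = tracked_abscissa D t T w (r \<mu>) \<epsilon> \<mu>" for \<epsilon> \<mu>
  define m where "m \<epsilon> = max_of (tracked_abscissas D t T w r \<epsilon>)" for \<epsilon>
  have pos: "0 < \<epsilon>" if "adm \<epsilon>" for \<epsilon>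
    using that by (simp add: adm_def admissible_def)
  have loc: "eigval_tracking D t T w \<mu> (r \<mu>) \<epsilon>" if "adm \<epsilon>" "\<mu> \<in> \<Lambda>" for \<epsilon> \<mu>
  proof (rule eigval_trackingI[OF assms(1,2)])
    show "0 < \<epsilon>" using that pos by blast
    moreover have "{0..\<epsilon>} \<subseteq> U \<mu>" using that by (simp add: adm_def admissible_def \<Lambda>_def)
    ultimately show "\<epsilon> \<in> U \<mu>" by auto
  qed (use that nbhd in \<open>simp_all add: \<Lambda>_def\<close>)
  have R_le_m: "R \<epsilon> \<mu> \<le> m \<epsilon>" if "adm \<epsilon>" "\<mu> \<in> \<Lambda>" for \<epsilon> \<mu>
    unfolding m_def by (rule max_of_ge)
      (use that in \<open>simp_all add: adm_def admissible_def tracked_abscissas_def R_def \<Lambda>_def\<close>)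
  have m_attained: "\<exists>\<mu>\<in>\<Lambda>. m \<epsilon> = R \<epsilon> \<mu>" if "adm \<epsilon>" for \<epsilon>
  proof -
    have "m \<epsilon> \<in> tracked_abscissas D t T w r \<epsilon>"
      unfolding m_def by (rule max_of_in) (use that in \<open>simp add: adm_def admissible_def\<close>)
    thus ?thesis by (auto simp: tracked_abscissas_def R_def \<Lambda>_def)
  qed

  have abscissa_eq: "pseudospectral_abscissa D t T w \<epsilon> = m \<epsilon>"
    if \<epsilon>: "adm \<epsilon>" and cont: "rightmost_continued D t T w \<epsilon>" for \<epsilon>
  proof (rule antisym)
    obtain \<Delta> \<gamma> where \<Delta>: "\<Delta> \<in> pert_set 1" and \<gamma>: "continuous_on {0..\<epsilon>} \<gamma>"
        "\<And>\<eta>. \<eta> \<in> {0..\<epsilon>} \<Longrightarrow> \<gamma> \<eta> \<in> pert_eigvals D t T w \<Delta> \<eta>"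
        "Re (\<gamma> \<epsilon>) = pseudospectral_abscissa D t T w \<epsilon>"
      using cont unfolding rightmost_continued_def by blast
    have start: "\<gamma> 0 \<in> \<Lambda>"
      using \<gamma>(2)[of 0] pos[OF \<epsilon>] by (simp add: \<Lambda>_def)
    interpret eigval_tracking D t T w "\<gamma> 0" "r (\<gamma> 0)" \<epsilon>
      by (rule loc[OF \<epsilon> start])
    have B: "spectral_norm (block_row \<Delta>) \<le> 1"
      using \<Delta> by (simp add: pert_set_def)
    have "\<gamma> \<epsilon> = eig_path (block_row \<Delta>) (of_real \<epsilon>)"
    proof (rule continued_path[OF B _ _ \<gamma>(1)])
      show "char_fun (cscale (of_real \<eta>) (block_row \<Delta>)) (\<gamma> \<eta>) = 0" if "\<eta> \<in> {0..\<epsilon>}" for \<eta>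
        using \<gamma>(2)[OF that] by (simp add: eigvals_def scaled_pert_eq_block_pert char_fun_def)
    qed (use pos[OF \<epsilon>] in auto)
    moreover have "Re (eig_path (block_row \<Delta>) (of_real \<epsilon>)) \<le> R \<epsilon> (\<gamma> 0)"
      unfolding eig_path_def R_def
      using pos[OF \<epsilon>] by (intro tracked_le_tracked_abscissa cscale_le B) auto
    ultimately show "pseudospectral_abscissa D t T w \<epsilon> \<le> m \<epsilon>"
      using R_le_m[OF \<epsilon> start] \<gamma>(3) by simp
  next
    obtain \<mu> where \<mu>: "\<mu> \<in> \<Lambda>" "m \<epsilon> = R \<epsilon> \<mu>"
      using m_attained[OF \<epsilon>] by blast
    interpret eigval_tracking D t T w \<mu> "r \<mu>" \<epsilon>
      by (rule loc[OF \<epsilon> \<mu>(1)])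
    obtain B where B: "spectral_norm B \<le> \<epsilon>" "R \<epsilon> \<mu> = Re (tracked B)"
      using tracked_le_tracked_abscissa(2)[OF pos[OF \<epsilon>] order_refl] unfolding R_def by blast
    have "B \<in> block_row ` pert_set \<epsilon>"
      using B(1) by (simp add: block_row_image_pert_set)
    then obtain \<Delta> where \<Delta>: "\<Delta> \<in> pert_set \<epsilon>" "B = block_row \<Delta>" by blast
    have "tracked B \<in> eigvals D (\<lambda>z. matfun t T z + pert t w \<Delta> z)"
      using tracked_in_D[OF B(1)] tracked_root[OF B(1)] by (simp add: eigvals_def pert_eq_block_pert \<Delta>(2))
    hence "Re (tracked B) \<in> Re ` pseudospectrum D t T w \<epsilon>"
      using \<Delta>(1) unfolding pseudospectrum_def by blast
    thus "m \<epsilon> \<le> pseudospectral_abscissa D t T w \<epsilon>"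
      unfolding pseudospectral_abscissa_def \<mu>(2) B(2)
      by (intro max_of_ge) (use \<epsilon> in \<open>simp_all add: adm_def admissible_def\<close>)
  qed

  \<comment> \<open>Everything is compared with one fixed admissible \<open>\<rho>\<close>; if there is none, the limits are vacuous.\<close>
  have "\<exists>C. \<exists>\<delta>>0. \<forall>\<epsilon>. adm \<epsilon> \<and> \<epsilon> < \<delta> \<longrightarrow> bdd_above (first_order_abscissas D t T w x y \<epsilon>) \<and>
      \<bar>m \<epsilon> - Sup (first_order_abscissas D t T w x y \<epsilon>)\<bar> \<le> C * \<epsilon>\<^sup>2"
  proof (cases "\<exists>\<rho>. adm \<rho>")
    case False
    thus ?thesis by (intro exI[of _ 0] exI[of _ 1]) auto
  next
    case True
    then obtain \<rho> where \<rho>: "adm \<rho>" by blast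
    note \<rho>0 = pos[OF \<rho>]
    obtain s where s: "s \<in> \<Lambda>" using m_attained[OF \<rho>] by blast
    \<comment> \<open>Adding \<open>1\<close> makes the bound on the real parts strict, as the half-plane estimate requires.\<close>
    define M where "M = m \<rho> + 1"
    define K where "K \<mu> = sqrt (\<Sum>j\<in>UNIV. (w j)\<^sup>2 * (cmod (t j \<mu>))\<^sup>2)
        / cmod (sesq (y \<mu>) (mat_deriv (matfun t T) \<mu>) (x \<mu>))" for \<mu>
    \<comment> \<open>The bound \<open>\<rho> / 24\<close> gives \<open>\<epsilon> * K \<mu> \<le> (M - Re \<mu>) / 4\<close> and \<open>96 * (\<epsilon> / \<rho>)\<^sup>2 \<le> 1/4\<close>.\<close>
    have bounds: "bdd_above (first_order_abscissas D t T w x y \<epsilon>) \<and>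
        \<bar>m \<epsilon> - Sup (first_order_abscissas D t T w x y \<epsilon>)\<bar> \<le> 2 * 96 / \<rho>\<^sup>2 * (M - Re s) * \<epsilon>\<^sup>2"
      if \<epsilon>: "adm \<epsilon>" "\<epsilon> < \<rho> / 24" for \<epsilon>
    proof -
      note \<epsilon>0 = pos[OF \<epsilon>(1)]
      have small: "\<epsilon> \<le> \<rho> / 4" "\<epsilon> \<le> \<rho>" using \<epsilon> \<rho>0 by simp_all
      obtain \<mu>1 where \<mu>1: "\<mu>1 \<in> \<Lambda>" "m \<epsilon> = R \<epsilon> \<mu>1"
        using m_attained[OF \<epsilon>(1)] by blast
      define e where "e = 96 / \<rho>\<^sup>2 * \<epsilon>\<^sup>2"
      have e: "0 \<le> e" "e \<le> 1/4"
      proof -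
        have "(24 * \<epsilon>)\<^sup>2 \<le> \<rho>\<^sup>2"
          using \<epsilon> \<epsilon>0 by (intro power_mono) auto
        hence "576 * \<epsilon>\<^sup>2 \<le> \<rho>\<^sup>2"
          by (simp add: power_mult_distrib)
        hence "384 * \<epsilon>\<^sup>2 \<le> \<rho>\<^sup>2"
          using zero_le_power2[of \<epsilon>] by linarith
        thus "e \<le> 1/4" using \<rho>0 by (simp add: e_def field_simps)
      qed (simp add: e_def)
      have per: "Re \<mu> \<le> R \<epsilon> \<mu>" "Re \<mu> \<le> Re \<mu> + \<epsilon> * K \<mu>" "Re \<mu> \<le> M"
          "\<bar>R \<epsilon> \<mu> - (Re \<mu> + \<epsilon> * K \<mu>)\<bar> \<le> e * (M - Re \<mu>)"
          "Re \<mu> + \<epsilon> * K \<mu> \<le> Re \<mu> + (M - Re \<mu>) / 4" if \<mu>: "\<mu> \<in> \<Lambda>" for \<mu>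
      proof -
        interpret eigval_tracking D t T w \<mu> "r \<mu>" \<rho>
          by (rule loc[OF \<rho> \<mu>])
        have K: "K \<mu> = speed (x \<mu>) (y \<mu>)" by (simp add: K_def speed_def)
        have M: "tracked_abscissa D t T w (r \<mu>) \<rho> \<mu> < M"
          using R_le_m[OF \<rho> \<mu>] by (simp add: M_def R_def)
        show "Re \<mu> \<le> R \<epsilon> \<mu>"
          unfolding R_def by (rule Re_le_tracked_abscissa[OF \<epsilon>0 small(2)])
        show "Re \<mu> \<le> Re \<mu> + \<epsilon> * K \<mu>"
          using \<epsilon>0 speed_nonneg[of "x \<mu>" "y \<mu>"] by (simp add: K)
        show ReM: "Re \<mu> \<le> M"
          using Re_le_tracked_abscissa[OF \<rho>0 order_refl] M by simp
        note expansion = tracked_abscissa_expansion[OF M right left \<epsilon>0 small(1)]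
        show "\<bar>R \<epsilon> \<mu> - (Re \<mu> + \<epsilon> * K \<mu>)\<bar> \<le> e * (M - Re \<mu>)"
        proof -
          have "96 * (M - Re \<mu>) / \<rho>\<^sup>2 * \<epsilon>\<^sup>2 = e * (M - Re \<mu>)"
            by (simp add: e_def algebra_simps)
          with expansion(1) \<mu> show ?thesis
            by (simp only: R_def K \<Lambda>_def)
        qed
        have "\<epsilon> * K \<mu> \<le> \<rho> / 24 * (6 * (M - Re \<mu>) / \<rho>)"
          using expansion(2) \<mu> \<epsilon> \<epsilon>0 \<rho>0 speed_nonneg[of "x \<mu>" "y \<mu>"]
          by (intro mult_mono) (simp_all add: K \<Lambda>_def)
        thus "Re \<mu> + \<epsilon> * K \<mu> \<le> Re \<mu> + (M - Re \<mu>) / 4"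
          using \<rho>0 by simp
      qed
      have first_order: "first_order_abscissas D t T w x y \<epsilon> = (\<lambda>\<mu>. Re \<mu> + \<epsilon> * K \<mu>) ` \<Lambda>"
        by (simp add: first_order_abscissas_def K_def \<Lambda>_def)
      have "R \<epsilon> \<mu> \<le> R \<epsilon> \<mu>1" if "\<mu> \<in> \<Lambda>" for \<mu>
        using R_le_m[OF \<epsilon>(1) that] \<mu>1(2) by simp
      note comparison = Sup_close_to_max[where a = "R \<epsilon>" and b = "\<lambda>\<mu>. Re \<mu> + \<epsilon> * K \<mu>" and \<rho> = Re,
          OF \<mu>1(1) this s per e]
      have const: "2 * 96 / \<rho>\<^sup>2 * (M - Re s) * \<epsilon>\<^sup>2 = 2 * e * (M - Re s)"
        by (simp add: e_def)
      show ?thesis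
        unfolding first_order \<mu>1(2) const by (intro conjI comparison)
    qed
    show ?thesis
    proof (rule exI[of _ "2 * 96 / \<rho>\<^sup>2 * (M - Re s)"], rule exI[of _ "\<rho> / 24"], rule conjI)
      show "0 < \<rho> / 24" using \<rho>0 by simp
    qed (intro allI impI, elim conjE, rule bounds)
  qed
  then obtain C \<delta> where \<delta>: "\<delta> > 0" and uniform: "\<forall>\<epsilon>. adm \<epsilon> \<and> \<epsilon> < \<delta> \<longrightarrow>
      bdd_above (first_order_abscissas D t T w x y \<epsilon>) \<and>
      \<bar>m \<epsilon> - Sup (first_order_abscissas D t T w x y \<epsilon>)\<bar> \<le> C * \<epsilon>\<^sup>2"
    by (elim exE conjE) (rule that)
  have bdd: "bdd_above (first_order_abscissas D t T w x y \<epsilon>)"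
    and close: "\<bar>m \<epsilon> - Sup (first_order_abscissas D t T w x y \<epsilon>)\<bar> \<le> C * \<epsilon>\<^sup>2"
    if "adm \<epsilon>" "\<epsilon> < \<delta>" for \<epsilon>
    using uniform[rule_format, OF conjI[OF that]] by (rule conjunct1, rule conjunct2)
  have near_0: "\<forall>\<^sub>F \<epsilon> in at 0 within S. P \<epsilon>"
    if "\<And>\<epsilon>. \<epsilon> \<in> S \<Longrightarrow> \<epsilon> < \<delta> \<Longrightarrow> P \<epsilon>" for P S
    unfolding eventually_at using that \<delta> by (intro exI[of _ \<delta>]) (auto simp: dist_real_def)
  show ?thesis
  proof (intro conjI allI impI)
    show "pseudospectral_abscissa D t T w \<epsilon> = max_of (tracked_abscissas D t T w r \<epsilon>)"
      if "admissible D t T w U r \<epsilon> \<and> rightmost_continued D t T w \<epsilon>" for \<epsilon>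
      using abscissa_eq[of \<epsilon>] that by (simp add: adm_def m_def)
    show "\<forall>\<^sub>F \<epsilon> in at 0 within {\<epsilon>. admissible D t T w U r \<epsilon>}.
            bdd_above (first_order_abscissas D t T w x y \<epsilon>)"
      by (rule near_0) (simp add: bdd adm_def)
    show "(\<lambda>\<epsilon>. max_of (tracked_abscissas D t T w r \<epsilon>) - Sup (first_order_abscissas D t T w x y \<epsilon>))
            \<in> O[at 0 within {\<epsilon>. admissible D t T w U r \<epsilon>}](\<lambda>\<epsilon>. \<epsilon>\<^sup>2)"
      by (rule bigoI[where c = C], rule near_0) (use close in \<open>simp add: adm_def m_def\<close>)
    show "(\<lambda>\<epsilon>. pseudospectral_abscissa D t T w \<epsilon> - Sup (first_order_abscissas D t T w x y \<epsilon>))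
            \<in> O[at 0 within {\<epsilon>. admissible D t T w U r \<epsilon> \<and> rightmost_continued D t T w \<epsilon>}](\<lambda>\<epsilon>. \<epsilon>\<^sup>2)"
      by (rule bigoI[where c = C], rule near_0) (use close abscissa_eq in \<open>simp add: adm_def\<close>)
  qed
qed

end
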